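(* Let $1<p<\infty$. Let $(b_n)_{n\ge1}$ be a sequence of elements of the closed unit ball of $H^\infty$. Put $B_0=1$ and $B_n:=b_1b_2\cdots b_n$ for $n\ge1$. Assume that $\lim_{n\to\infty}B_n(z)=0$ for every $z\in\mathbb{D}$. Then for every $f\in H^p$, \[ f=\sum_{n=1}^{\infty}B_{n-1}\cdot Q_{b_n}T_{\bar B_{n-1}}f, \] where the series converges in $H^p$-norm.
   Context: $\mathbb{D}$ is the open unit disc and $\mathbb{T}$ the unit circle; $H^p$ ($1<p<\infty$) is the Hardy space on $\mathbb{D}$, identified with a closed subspace of $L^p(\mathbb{T})$ via boundary values, and $H^\infty$ is the space of bounded analytic functions on $\mathbb{D}$ with the sup norm. $P_+:L^p(\mathbb{T})\to H^p$ is the M. Riesz (Szegő) projection. For $\varphi\in L^\infty(\mathbb{T})$ the Toeplitz operator $T_\varphi:H^p\to H^p$ is $T_\varphi f=P_+(\varphi f)$; for $B\in H^\infty$, $\bar B$ denotes the complex conjugate of its boundary function, so $T_{\bar B}$ is a co-analytic Toeplitz operator. For $b$ in the closed unit ball of $H^\infty$, $P_b:=T_bT_{\bar b}$ and $Q_b:=I-P_b$ (so $P_bf=bT_{\bar b}f$). *)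

theory Defs
  imports "HOL-Analysis.Analysis"
begin

text \<open>Hardy spaces are modelled inside the disc: a function on the disc together with
  its integral means on circles of radius r < 1. The boundary-value norm of H^p equals the
  supremum of the integral means, so this is the standard identification.\<close>

definition circle_mean :: "real \<Rightarrow> (complex \<Rightarrow> complex) \<Rightarrow> real \<Rightarrow> real" where
  "circle_mean p f r = (1 / (2*pi)) * integral {0..2*pi} (\<lambda>t. norm (f (complex_of_real r * cis t)) powr p)"

definition in_Hp :: "real \<Rightarrow> (complex \<Rightarrow> complex) \<Rightarrow> bool" where
  "in_Hp p f \<longleftrightarrow> f holomorphic_on ball 0 1 \<and> bdd_above (circle_mean p f ` {0..<1})"

definition Hp_norm :: "real \<Rightarrow> (complex \<Rightarrow> complex) \<Rightarrow> real" where
  "Hp_norm p f = (SUP r\<in>{0..<1}. circle_mean p f r) powr (1 / p)"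

definition in_Hinf_ball :: "(complex \<Rightarrow> complex) \<Rightarrow> bool" where
  "in_Hinf_ball b \<longleftrightarrow> b holomorphic_on ball 0 1 \<and> (\<forall>z\<in>ball 0 1. norm (b z) \<le> 1)"

text \<open>Co-analytic Toeplitz operator T_{conj B} f = P_+(conj B * f), with P_+ given by the
  Szego (Cauchy) kernel: P_+ h (z) = (1/2pi) int h(e^{it}) / (1 - z e^{-it}) dt.
  The boundary values of conj B * f are reached as the L^1 limit of the radius-r
  restrictions, r \<rightarrow> 1-.\<close>
definition toeplitz_conj :: "(complex \<Rightarrow> complex) \<Rightarrow> (complex \<Rightarrow> complex) \<Rightarrow> complex \<Rightarrow> complex" where
  "toeplitz_conj B f = (\<lambda>z. Lim (at_left 1) (\<lambda>r::real.
      complex_of_real (1 / (2*pi)) * integral {0..2*pi}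
        (\<lambda>t. cnj (B (complex_of_real r * cis t)) * f (complex_of_real r * cis t)
              / (1 - z * cnj (cis t)))))"

text \<open>Q_b = I - T_b T_{conj b}; T_b is multiplication by the analytic function b.\<close>
definition Qop :: "(complex \<Rightarrow> complex) \<Rightarrow> (complex \<Rightarrow> complex) \<Rightarrow> complex \<Rightarrow> complex" where
  "Qop b h = (\<lambda>z. h z - b z * toeplitz_conj b h z)"

definition Bprod :: "(nat \<Rightarrow> complex \<Rightarrow> complex) \<Rightarrow> nat \<Rightarrow> complex \<Rightarrow> complex" where
  "Bprod b n = (\<lambda>z. \<Prod>k\<in>{1..n}. b k z)"

end

theory Submission
  imports Defs "HOL-Complex_Analysis.Complex_Analysis"
begin

text \<open>On the disc the \<open>n\<close>-th term equals \<open>B\<^sub>n\<^sub>-\<^sub>1 T\<^sub>n\<^sub>-\<^sub>1 f - B\<^sub>n T\<^sub>n f\<close>, where \<open>T\<^sub>n\<close> is the co-analytic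
  Toeplitz operator of \<open>B\<^sub>n\<close>, because \<open>T\<^sub>n\<close> is the composition of the Toeplitz operators of the
  conjugates of \<open>b\<^sub>n\<close> and \<open>B\<^sub>n\<^sub>-\<^sub>1\<close>. The series telescopes and it remains to see that
  \<open>T\<^sub>n f\<close> tends to \<open>0\<close> in norm. The Cauchy kernels \<open>1 / (1 - cnj w * z)\<close> are eigenvectors of
  \<open>T\<^sub>n\<close> with eigenvalue \<open>cnj (B\<^sub>n w)\<close>, which tends to \<open>0\<close>; their span is dense, and the \<open>T\<^sub>n\<close> are
  uniformly bounded by M. Riesz's theorem.

  Boundary values are never used. Riesz's inequality is proved for continuous data on the circle
  and its Szego integral on interior circles: for \<open>p \<le> 2\<close> from a pointwise inequality for
  \<open>F powr p\<close> with \<open>Re F > 0\<close>, for \<open>p > 2\<close> by duality. Dilates of \<open>f\<close> converge to \<open>f\<close> in norm by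
  uniform convexity, and Riemann sums of Cauchy's integral turn dilates into kernel sums.\<close>

section \<open>Circle means and the Poisson kernel\<close>

text \<open>\<open>toeplitz_conj\<close> is a \<open>Lim\<close> of integrals over interior circles,
  and \<open>Lim\<close> says something only once convergence is known; existence of the limit is
  therefore part of the work. On kernels the integrals have a closed form with an evident limit, and
  a pointwise bound uniform in the radius carries convergence over to all of \<open>H^p\<close> by
  density. For this reason density precedes every statement about Toeplitz operators. Its obstacle
  is the norm convergence of dilates: without a boundary function there is nothing to approximate on
  the circle itself, and convexity of the p-th power takes the place of continuity of the L^p norm.
  The composition law also comes from density: on a kernel both sides multiply by
  \<open>cnj (B w) * cnj (b w)\<close>. Norms are handled through bounds on p-th powers of moduli. A
  factor \<open>2 powr p\<close> replaces Minkowski's inequality, which is harmless because only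
  boundedness and convergence to 0 matter. The restriction \<open>p \<le> 2\<close> in the first
  half of Riesz's theorem keeps the argument of \<open>F powr p\<close> between -pi and pi, where
  cosine decreases in the modulus of the argument.\<close>

lemma continuous_on_powr_nonneg [continuous_intros]:
  fixes f :: "'a::topological_space \<Rightarrow> real"
  assumes "continuous_on S f" "\<And>x. x \<in> S \<Longrightarrow> 0 \<le> f x" "0 < p"
  shows "continuous_on S (\<lambda>x. f x powr p)"
  using assms by (intro continuous_on_powr' continuous_on_const) auto

text \<open>That rule asks for a nonzero base, which fails for the modulus of a function with zeros;
  the rule above takes its place.\<close>

declare continuous_on_powr [continuous_intros del]

text \<open>Means are formed from functions of the angle with values in any Euclidean space, so that
  real moduli and complex integrands share one set of rules.\<close>

definition cmean :: "(real \<Rightarrow> 'a::euclidean_space) \<Rightarrow> 'a" where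
  "cmean g = (1 / (2*pi)) *\<^sub>R integral {0..2*pi} g"

lemma circle_mean_eq_cmean:
  "circle_mean p f r = cmean (\<lambda>t. norm (f (of_real r * cis t)) powr p)"
  by (simp add: circle_mean_def cmean_def)

lemma cont_integrable:
  fixes g :: "real \<Rightarrow> 'a::euclidean_space"
  assumes "continuous_on UNIV g"
  shows "g integrable_on {a..b}"
  by (meson assms continuous_on_subset integrable_continuous_interval subset_UNIV)

lemma cmean_add:
  assumes "continuous_on UNIV f" "continuous_on UNIV g"
  shows "cmean (\<lambda>t. f t + g t) = cmean f + cmean g"
  unfolding cmean_def using assms
  by (subst integral_add) (auto intro: cont_integrable simp: scaleR_add_right)

lemma cmean_diff:
  assumes "continuous_on UNIV f" "continuous_on UNIV g"
  shows "cmean (\<lambda>t. f t - g t) = cmean f - cmean g"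
  unfolding cmean_def using assms
  by (subst integral_diff) (auto intro: cont_integrable simp: scaleR_diff_right)

lemma cmean_linear:
  assumes "bounded_linear h" "continuous_on UNIV f"
  shows "cmean (\<lambda>t. h (f t)) = h (cmean f)"
proof -
  have "integral {0..2*pi} (\<lambda>t. h (f t)) = h (integral {0..2*pi} f)"
    using integral_linear[OF cont_integrable[OF assms(2)] assms(1)] by (simp add: o_def)
  then show ?thesis
    using assms(1) by (simp add: cmean_def linear_simps)
qed

lemma cmean_cmult:
  fixes c :: "'a::{euclidean_space,real_normed_algebra}"
  assumes "continuous_on UNIV f"
  shows "cmean (\<lambda>t. c * f t) = c * cmean f"
  by (rule cmean_linear[OF bounded_linear_mult_right assms])

lemma cmean_cmult_right:
  fixes c :: "'a::{euclidean_space,real_normed_algebra}"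
  assumes "continuous_on UNIV f"
  shows "cmean (\<lambda>t. f t * c) = cmean f * c"
  by (rule cmean_linear[OF bounded_linear_mult_left assms])

lemma cmean_const [simp]: "cmean (\<lambda>t. c) = c"
  by (simp add: cmean_def)

lemma cmean_sum:
  assumes "finite I" "\<And>i. i \<in> I \<Longrightarrow> continuous_on UNIV (f i)"
  shows "cmean (\<lambda>t. \<Sum>i\<in>I. f i t) = (\<Sum>i\<in>I. cmean (f i))"
  unfolding cmean_def using assms
  by (subst integral_sum) (auto intro: cont_integrable simp: scaleR_sum_right)

lemma cmean_mono:
  fixes f g :: "real \<Rightarrow> real"
  assumes "continuous_on UNIV f" "continuous_on UNIV g" "\<And>t. f t \<le> g t"
  shows "cmean f \<le> cmean g"
  unfolding cmean_def using assms
  by (auto intro!: divide_right_mono integral_le cont_integrable)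

lemma cmean_nonneg:
  fixes f :: "real \<Rightarrow> real"
  assumes "continuous_on UNIV f" "\<And>t. 0 \<le> f t"
  shows "0 \<le> cmean f"
  using cmean_mono[of "\<lambda>_. 0" f] assms by auto

lemma norm_cmean_le:
  assumes "continuous_on UNIV f"
  shows "norm (cmean f) \<le> cmean (\<lambda>t. norm (f t))"
proof -
  have "norm (integral {0..2*pi} f) \<le> integral {0..2*pi} (\<lambda>t. norm (f t))"
    using assms by (intro integral_norm_bound_integral cont_integrable continuous_intros) auto
  then show ?thesis
    by (simp add: cmean_def divide_right_mono)
qed

lemma cmean_continuous_param:
  fixes f :: "'a::topological_space \<Rightarrow> real \<Rightarrow> 'b::euclidean_space"
  assumes "continuous_on (U \<times> UNIV) (\<lambda>(x, t). f x t)"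
  shows "continuous_on U (\<lambda>x. cmean (f x))"
  unfolding cmean_def
  using integral_continuous_on_param[of U 0 "2*pi" f] continuous_on_subset[OF assms]
  by (intro continuous_intros) (auto simp: Sigma_mono)

lemma cmean_swap:
  fixes f :: "real \<Rightarrow> real \<Rightarrow> 'b::euclidean_space"
  assumes "continuous_on UNIV (\<lambda>(x, t). f x t)"
  shows "cmean (\<lambda>x. cmean (f x)) = cmean (\<lambda>t. cmean (\<lambda>x. f x t))"
proof -
  have c1: "continuous_on UNIV (\<lambda>x. integral {0..2*pi} (f x))"
    using integral_continuous_on_param[of UNIV 0 "2*pi" f] continuous_on_subset[OF assms]
    by simp
  have "continuous_on UNIV (\<lambda>(t, x). f x t)"
    using continuous_on_compose2[OF assms continuous_on_swap[of UNIV]] by (simp add: case_prod_unfold)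
  then have c2: "continuous_on UNIV (\<lambda>t. integral {0..2*pi} (\<lambda>x. f x t))"
    using integral_continuous_on_param[of UNIV 0 "2*pi" "\<lambda>t x. f x t"] continuous_on_subset by fastforce
  have "integral {0..2*pi} (\<lambda>x. integral {0..2*pi} (f x)) =
        integral {0..2*pi} (\<lambda>t. integral {0..2*pi} (\<lambda>x. f x t))"
    using integral_swap_continuous[of 0 0 "2*pi" "2*pi" f] continuous_on_subset[OF assms] by simp
  then show ?thesis
    using c1 c2 by (simp add: cmean_def cont_integrable integral_cmul)
qed

lemma continuous_on_circle:
  assumes "continuous_on (ball 0 1) f" "\<bar>r\<bar> < 1"
  shows "continuous_on UNIV (\<lambda>t. f (complex_of_real r * cis t))"
  by (rule continuous_on_compose2[OF assms(1)])
     (use assms(2) in \<open>auto intro!: continuous_intros simp: norm_mult\<close>)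

text \<open>Cauchy's formula with du = i \<open>cis t\<close> dt: the factor \<open>cis t\<close> in
  the integrand is what is left of du after division by i.\<close>

lemma Cauchy_circle_mean:
  assumes "continuous_on (cball 0 1) G" "G holomorphic_on ball 0 1" "norm z < 1"
  shows "cmean (\<lambda>t. G (cis t) * cis t / (cis t - z)) = G z"
proof -
  have "((\<lambda>u. G u / (u - z)) has_contour_integral (2 * of_real pi * \<i> * G z)) (circlepath 0 1)"
    using assms by (intro Cauchy_integral_circlepath) auto
  then have "((\<lambda>t. G (cis t) / (cis t - z) * \<i> * cis t) has_integral 2 * of_real pi * \<i> * G z) {0..2*pi}"
    unfolding circlepath_def by (subst (asm) has_contour_integral_part_circlepath_iff) auto
  then have "((\<lambda>t. (G (cis t) / (cis t - z) * \<i> * cis t) * (- \<i>)) has_integral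
      (2 * of_real pi * \<i> * G z) * (- \<i>)) {0..2*pi}"
    by (rule has_integral_mult_left)
  moreover have "(\<lambda>t. (G (cis t) / (cis t - z) * \<i> * cis t) * (- \<i>)) = (\<lambda>t. G (cis t) * cis t / (cis t - z))"
    by (auto simp: fun_eq_iff algebra_simps)
  ultimately have "((\<lambda>t. G (cis t) * cis t / (cis t - z)) has_integral 2 * of_real pi * G z) {0..2*pi}"
    by (simp add: algebra_simps)
  then show ?thesis
    by (simp add: cmean_def integral_unique scaleR_conv_of_real)
qed

lemma circle_mean_value:
  assumes "continuous_on (cball 0 1) G" "G holomorphic_on ball 0 1"
  shows "cmean (\<lambda>t. G (cis t)) = G 0"
  using Cauchy_circle_mean[OF assms, of 0] by simp

section \<open>The Poisson kernel and Poisson integrals\<close>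

definition poisson :: "complex \<Rightarrow> real \<Rightarrow> real" where
  "poisson z t = Re ((cis t + z) / (cis t - z))"

lemma cnj_cis_eq: "cnj (cis t) = 1 / cis t"
  by (simp add: cis_cnj cis_inverse inverse_eq_divide [symmetric])

lemma cis_minus_nz: "norm z < 1 \<Longrightarrow> cis t - z \<noteq> 0"
  by (metis eq_iff_diff_eq_0 norm_cis order_less_irrefl)

text \<open>The definition is the real part of the Herglotz kernel, which is analytic in z; this is
  the classical form, from which positivity and symmetry are read off.\<close>

lemma poisson_eq:
  assumes "norm z < 1"
  shows "poisson z t = (1 - (norm z)\<^sup>2) / (norm (cis t - z))\<^sup>2"
proof -
  have "Re ((cis t + z) * cnj (cis t - z)) = 1 - (norm z)\<^sup>2"
    unfolding cmod_power2 using sin_cos_squared_add[of t] by (simp add: power2_eq_square algebra_simps)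
  then show ?thesis
    unfolding poisson_def Re_divide_numeral
    by (subst complex_div_cnj) (simp add: Re_divide_of_real)
qed

lemma poisson_pos: "norm z < 1 \<Longrightarrow> 0 < poisson z t"
  using cis_minus_nz[of z t] by (auto simp: poisson_eq abs_square_less_1 intro!: divide_pos_pos)

text \<open>The distance between \<open>cis a\<close> and r \<open>cis b\<close> depends on the
  angles only through cos (a - b), so the two angles may be exchanged.\<close>

lemma poisson_swap:
  assumes "\<bar>r\<bar> < 1"
  shows "poisson (of_real r * cis x) t = poisson (of_real r * cis t) x"
proof -
  have "(norm (cis a - of_real r * cis b))\<^sup>2 = 1 + r\<^sup>2 - 2 * r * (cos a * cos b + sin a * sin b)" for a b
  proof -
    have "(norm (cis a - of_real r * cis b))\<^sup>2 = (cos a - r * cos b)\<^sup>2 + (sin a - r * sin b)\<^sup>2"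
      by (simp add: cmod_power2)
    then show ?thesis
      using sin_cos_squared_add[of a] sin_cos_squared_add[of b] by algebra
  qed
  then show ?thesis
    using assms by (simp add: poisson_eq norm_mult mult.commute)
qed

text \<open>The kernel splits into the Cauchy kernel and a term that, as a function of
  \<open>cis t\<close>, extends analytically to the disc and vanishes at 0. Against analytic data
  the first reproduces the value at z and the second contributes nothing.\<close>

lemma poisson_complex:
  assumes "norm z < 1"
  shows "of_real (poisson z t) = cis t / (cis t - z) + cnj z * cis t / (1 - cnj z * cis t)"
proof -
  have nz: "cis t - z \<noteq> 0" using cis_minus_nz[OF assms] .
  have nz': "1 - cnj z * cis t \<noteq> 0"
  proof
    assume "1 - cnj z * cis t = 0"
    then have "cnj z * cis t = 1" by simp
    then have "norm (cnj z * cis t) = 1" by (metis norm_one)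
    then show False using assms by (simp add: norm_mult)
  qed
  have "complex_of_real (poisson z t) =
        ((cis t + z) / (cis t - z) + cnj ((cis t + z) / (cis t - z))) / 2"
    by (simp only: poisson_def complex_add_cnj) simp
  also have "cnj ((cis t + z) / (cis t - z)) = (1 / cis t + cnj z) / (1 / cis t - cnj z)"
    by (simp only: complex_cnj_divide complex_cnj_add complex_cnj_diff cnj_cis_eq)
  also have "\<dots> = (1 + cnj z * cis t) / (1 - cnj z * cis t)"
    using nz' by (simp add: divide_simps)
  also have "((cis t + z) / (cis t - z) + (1 + cnj z * cis t) / (1 - cnj z * cis t)) / 2 =
       cis t / (cis t - z) + cnj z * cis t / (1 - cnj z * cis t)"
    using nz nz' by (simp add: divide_simps) (simp add: algebra_simps)
  finally show ?thesis .
qed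

lemma continuous_on_poisson_fixed [continuous_intros]:
  "norm z < 1 \<Longrightarrow> continuous_on A (poisson z)"
  unfolding poisson_def using cis_minus_nz by (intro continuous_intros) auto

lemma continuous_on_poisson_circle:
  assumes "\<bar>r\<bar> < 1"
  shows "continuous_on UNIV (\<lambda>(x, t). poisson (of_real r * cis x) t)"
proof -
  have "cis (snd p) - complex_of_real r * cis (fst p) \<noteq> 0" for p
    using cis_minus_nz[of "complex_of_real r * cis (fst p)"] assms by (simp add: norm_mult)
  then show ?thesis
    unfolding poisson_def case_prod_unfold by (intro continuous_intros) auto
qed

lemma poisson_representation:
  assumes "continuous_on (cball 0 1) G" "G holomorphic_on ball 0 1" "norm z < 1"
  shows "cmean (\<lambda>t. of_real (poisson z t) * G (cis t)) = G z"
proof -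
  have nz': "1 - cnj z * w \<noteq> 0" if "norm w \<le> 1" for w
  proof
    assume "1 - cnj z * w = 0"
    then have "norm (cnj z * w) = 1" by (metis eq_iff_diff_eq_0 norm_one)
    moreover have "norm z * norm w \<le> norm z"
      using that by (simp add: mult_left_le)
    ultimately show False using assms(3) by (simp add: norm_mult)
  qed
  have cG: "continuous_on UNIV (\<lambda>t. G (cis t))"
    by (rule continuous_on_compose2[OF assms(1)]) (auto intro!: continuous_intros)
  \<comment> \<open>The factor \<open>w\<close> makes \<open>K 0 = 0\<close>, so the mean value
    property removes this part of the kernel.\<close>
  define K where "K = (\<lambda>w. G w * (cnj z * w / (1 - cnj z * w)))"
  have "cmean (\<lambda>t. K (cis t)) = K 0"
    unfolding K_def using assms nz'
    by (intro circle_mean_value holomorphic_intros continuous_intros) auto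
  moreover have "cmean (\<lambda>t. of_real (poisson z t) * G (cis t)) =
        cmean (\<lambda>t. G (cis t) * cis t / (cis t - z) + K (cis t))"
    using poisson_complex[OF assms(3)] by (simp add: K_def algebra_simps)
  moreover have "\<dots> = cmean (\<lambda>t. G (cis t) * cis t / (cis t - z)) + cmean (\<lambda>t. K (cis t))"
    unfolding K_def using nz' cis_minus_nz[OF assms(3)]
    by (intro cmean_add continuous_intros cG) auto
  ultimately show ?thesis
    using Cauchy_circle_mean[OF assms] by (simp add: K_def)
qed

lemma cmean_poisson: "norm z < 1 \<Longrightarrow> cmean (poisson z) = 1"
proof -
  assume z: "norm z < 1"
  have "complex_of_real (cmean (poisson z)) = cmean (\<lambda>t. complex_of_real (poisson z t))"
    by (rule cmean_linear[OF bounded_linear_of_real, symmetric]) (intro continuous_intros z)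
  also have "\<dots> = 1"
    using poisson_representation[of "\<lambda>_. 1" z] z by simp
  finally show ?thesis
    by (metis of_real_eq_1_iff)
qed

text \<open>Young's inequality for \<open>x\<close> and \<open>m powr (p - 1)\<close> is the tangent
  line inequality of the convex power in disguise; it covers \<open>x = 0\<close> without
  differentiating there.\<close>

lemma powr_tangent_le:
  fixes x m p :: real
  assumes "1 < p" "0 < m" "0 \<le> x"
  shows "m powr p + p * m powr (p - 1) * (x - m) \<le> x powr p"
proof -
  define q where "q = p / (p - 1)"
  have q: "1 < q" "1 / p + 1 / q = 1" using assms by (auto simp: q_def field_simps)
  have "x * m powr (p - 1) \<le> x powr p / p + (m powr (p - 1)) powr q / q"
    using assms q by (intro Youngs_inequality) auto
  moreover have "(m powr (p - 1)) powr q = m powr p"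
    using assms by (simp add: powr_powr q_def)
  moreover have "1 / q = 1 - 1 / p" using q by simp
  ultimately have "x * m powr (p - 1) \<le> x powr p / p + m powr p * (1 - 1 / p)"
    by (simp add: divide_inverse)
  then have "p * (x * m powr (p - 1)) \<le> p * (x powr p / p + m powr p * (1 - 1 / p))"
    using assms by (intro mult_left_mono) auto
  also have "\<dots> = x powr p + (p - 1) * m powr p"
    using assms by (simp add: field_simps)
  finally show ?thesis
    using assms powr_mult_base[of m "p - 1"] by (simp add: algebra_simps)
qed

lemma cmean_Jensen:
  fixes w h :: "real \<Rightarrow> real"
  assumes p: "1 < p" and w: "continuous_on UNIV w" "\<And>t. 0 \<le> w t" "cmean w = 1"
    and h: "continuous_on UNIV h" "\<And>t. 0 \<le> h t"
  shows "(cmean (\<lambda>t. w t * h t)) powr p \<le> cmean (\<lambda>t. w t * h t powr p)"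
proof -
  define m where "m = cmean (\<lambda>t. w t * h t)"
  have c: "continuous_on UNIV (\<lambda>t. h t powr p)"
    using h p by (intro continuous_intros) auto
  have p0: "0 < p" using p by simp
  have m0: "m \<ge> 0" unfolding m_def using w h by (intro cmean_nonneg continuous_intros) auto
  show ?thesis
  \<comment> \<open>The tangent inequality is available only at a positive point.\<close>
  proof (cases "m = 0")
    case True
    have "0 \<le> cmean (\<lambda>t. w t * h t powr p)"
      using w h p by (intro cmean_nonneg continuous_intros) auto
    then show ?thesis using True by (simp add: m_def[symmetric])
  next
    case False
    with m0 have m: "m > 0" by simp
    \<comment> \<open>\<open>a + b * x\<close> is the tangent to \<open>x powr p\<close> at m; its
      weighted mean is exactly \<open>m powr p\<close>.\<close>
    define a where "a = m powr p - p * m powr (p - 1) * m"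
    define b where "b = p * m powr (p - 1)"
    have "cmean (\<lambda>t. a * w t + b * (w t * h t)) \<le> cmean (\<lambda>t. w t * h t powr p)"
    proof (intro cmean_mono continuous_intros w h p0)
      fix t
      have "w t * (m powr p + p * m powr (p - 1) * (h t - m)) \<le> w t * h t powr p"
        by (intro mult_left_mono powr_tangent_le p m h w)
      then show "a * w t + b * (w t * h t) \<le> w t * h t powr p"
        by (simp add: a_def b_def algebra_simps)
    qed
    moreover have "cmean (\<lambda>t. a * w t + b * (w t * h t)) = a * cmean w + b * m"
      unfolding m_def using cmean_cmult[of w a] cmean_cmult[of "\<lambda>t. w t * h t" b] w(1) h(1)
      by (subst cmean_add) (auto intro!: continuous_intros)
    moreover have "a * cmean w + b * m = m powr p"
      by (simp add: w a_def b_def)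
    ultimately show ?thesis by (simp add: m_def)
  qed
qed

lemma cmean_powr_le:
  fixes h :: "real \<Rightarrow> real"
  assumes "1 < p" "continuous_on UNIV h" "\<And>t. 0 \<le> h t"
  shows "(cmean h) powr p \<le> cmean (\<lambda>t. h t powr p)"
  using cmean_Jensen[of p "\<lambda>_. 1" h] assms by simp

text \<open>Jensen's inequality with the Poisson kernel as probability density gives a pointwise
  bound; after Fubini the symmetry of the kernel turns the inner integral into its total mass
  1.\<close>

lemma cmean_poisson_integral_powr_le:
  fixes h :: "real \<Rightarrow> real"
  assumes p: "1 < p" and h: "continuous_on UNIV h" "\<And>t. 0 \<le> h t" and r: "0 \<le> r" "r < 1"
  shows "cmean (\<lambda>x. (cmean (\<lambda>t. poisson (of_real r * cis x) t * h t)) powr p)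
          \<le> cmean (\<lambda>t. h t powr p)"
proof -
  have nr: "norm (complex_of_real r * cis x) < 1" for x using r by (simp add: norm_mult)
  have c: "continuous_on UNIV (\<lambda>t. h t powr p)"
    using h p by (intro continuous_intros) auto
  have cp: "continuous_on UNIV (\<lambda>p. poisson (of_real r * cis (fst p)) (snd p))"
    using continuous_on_poisson_circle[of r] r by (simp add: case_prod_unfold)
  have hs: "continuous_on UNIV (\<lambda>p::real\<times>real. h (snd p))"
       "continuous_on UNIV (\<lambda>q::real\<times>real. h (snd q) powr p)"
    by (rule continuous_on_compose2[OF h(1)] continuous_on_compose2[OF c];
        auto intro!: continuous_intros)+
  have c2: "continuous_on UNIV (\<lambda>(x, t). poisson (of_real r * cis x) t * h t powr p)"
    and c3: "continuous_on UNIV (\<lambda>(x, t). poisson (of_real r * cis x) t * h t)"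
    unfolding case_prod_unfold by (intro continuous_intros cp hs)+
  have n: "0 \<le> cmean (\<lambda>t. poisson (of_real r * cis x) t * h t)" for x
    using h nr[of x] poisson_pos[OF nr[of x]]
    by (intro cmean_nonneg continuous_intros mult_nonneg_nonneg) (auto intro: less_imp_le)
  have "cmean (\<lambda>x. (cmean (\<lambda>t. poisson (of_real r * cis x) t * h t)) powr p)
      \<le> cmean (\<lambda>x. cmean (\<lambda>t. poisson (of_real r * cis x) t * h t powr p))"
  proof (intro cmean_mono)
    show "continuous_on UNIV (\<lambda>x. (cmean (\<lambda>t. poisson (of_real r * cis x) t * h t)) powr p)"
      using p n c3 by (intro continuous_on_powr_nonneg cmean_continuous_param) auto
    show "continuous_on UNIV (\<lambda>x. cmean (\<lambda>t. poisson (of_real r * cis x) t * h t powr p))"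
      using c2 by (intro cmean_continuous_param) auto
    show "(cmean (\<lambda>t. poisson (of_real r * cis x) t * h t)) powr p
       \<le> cmean (\<lambda>t. poisson (of_real r * cis x) t * h t powr p)" for x
      using nr[of x] poisson_pos[OF nr[of x]] h p
      by (intro cmean_Jensen cmean_poisson continuous_intros) (auto intro: less_imp_le)
  qed
  also have "\<dots> = cmean (\<lambda>t. cmean (\<lambda>x. poisson (of_real r * cis x) t * h t powr p))"
    using c2 by (rule cmean_swap)
  also have "\<dots> = cmean (\<lambda>t. cmean (\<lambda>x. poisson (of_real r * cis t) x * h t powr p))"
    using poisson_swap[of r] r by simp
  also have "\<dots> = cmean (\<lambda>t. h t powr p)"
    using nr by (subst cmean_cmult_right) (auto intro!: continuous_intros simp: cmean_poisson)
  finally show ?thesis .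
qed

lemma dilate_holomorphic:
  assumes "f holomorphic_on ball 0 1" "0 \<le> s" "s < 1"
  shows "(\<lambda>z. f (complex_of_real s * z)) holomorphic_on cball 0 1"
proof -
  have "complex_of_real s * z \<in> ball 0 1" if "norm z \<le> 1" for z
  proof -
    have "s * norm z \<le> s * 1" using that assms by (intro mult_left_mono) auto
    then have "s * norm z < 1" using assms by linarith
    then show ?thesis using assms by (simp add: norm_mult)
  qed
  then have "(f \<circ> (\<lambda>z. complex_of_real s * z)) holomorphic_on cball 0 1"
    by (intro holomorphic_on_compose_gen[OF _ assms(1)] holomorphic_intros) auto
  then show ?thesis by (simp add: o_def)
qed

text \<open>The values on radius r are the Poisson integral, at radius r / s, of the values on
  radius s, and Poisson integrals do not increase p-th means.\<close>

lemma circle_mean_mono: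
  assumes p: "1 < p" and f: "f holomorphic_on ball 0 1" and rs: "0 \<le> r" "r \<le> s" "s < 1"
  shows "circle_mean p f r \<le> circle_mean p f s"
proof (cases "r = s")
  case False
  then have s: "0 < s" "r < s" using rs by auto
  define u where "u = r / s"
  have u: "0 \<le> u" "u < 1" "u * s = r" using rs s by (auto simp: u_def)
  define G where "G = (\<lambda>z. f (of_real s * z))"

  have cf: "continuous_on (ball 0 1) f" using f by (rule holomorphic_on_imp_continuous_on)
  have "G holomorphic_on cball 0 1"
    unfolding G_def using f s rs by (intro dilate_holomorphic) auto
  then have G: "continuous_on (cball 0 1) G" "G holomorphic_on ball 0 1"
    using holomorphic_on_imp_continuous_on holomorphic_on_subset ball_subset_cball by blast+
  have cG: "continuous_on UNIV (\<lambda>t. G (cis t))"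
    by (rule continuous_on_compose2[OF G(1)]) (auto intro!: continuous_intros)
  have nr: "norm (complex_of_real u * cis x) < 1" for x using u by (simp add: norm_mult)
  have c3: "continuous_on UNIV (\<lambda>(x, t). poisson (of_real u * cis x) t * norm (G (cis t)))"
    unfolding case_prod_unfold
    using continuous_on_poisson_circle[of u] u
    by (intro continuous_intros continuous_on_compose2[OF cG]) (auto simp: case_prod_unfold)
  have le: "norm (f (of_real r * cis x)) \<le> cmean (\<lambda>t. poisson (of_real u * cis x) t * norm (G (cis t)))" for x
  proof -
    have "f (of_real r * cis x) = G (of_real u * cis x)"
      unfolding G_def u(3)[symmetric] by (simp add: mult_ac)
    also have "\<dots> = cmean (\<lambda>t. of_real (poisson (of_real u * cis x) t) * G (cis t))"
      using poisson_representation[OF G nr] by simp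
    also have "norm \<dots> \<le> cmean (\<lambda>t. norm (of_real (poisson (of_real u * cis x) t) * G (cis t)))"
      by (intro norm_cmean_le continuous_intros cG nr)
    finally show ?thesis
      using poisson_pos[OF nr] by (simp add: norm_mult abs_of_pos)
  qed
  have "circle_mean p f r = cmean (\<lambda>x. norm (f (of_real r * cis x)) powr p)"
    by (rule circle_mean_eq_cmean)
  also have "\<dots> \<le> cmean (\<lambda>x. (cmean (\<lambda>t. poisson (of_real u * cis x) t * norm (G (cis t)))) powr p)"
  proof (intro cmean_mono)
    show "continuous_on UNIV (\<lambda>x. norm (f (of_real r * cis x)) powr p)"
      using p rs by (intro continuous_intros continuous_on_circle cf) auto
    have "0 \<le> cmean (\<lambda>t. poisson (of_real u * cis x) t * norm (G (cis t)))" for x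
      using le[of x] norm_ge_zero order_trans by blast
    then show "continuous_on UNIV (\<lambda>x. (cmean (\<lambda>t. poisson (of_real u * cis x) t * norm (G (cis t)))) powr p)"
      using p c3 by (intro continuous_on_powr_nonneg cmean_continuous_param) auto
  qed (use p le in \<open>auto intro!: powr_mono2\<close>)
  also have "\<dots> \<le> cmean (\<lambda>t. norm (G (cis t)) powr p)"
    using u p cG by (intro cmean_poisson_integral_powr_le continuous_intros) auto
  also have "\<dots> = circle_mean p f s"
    by (simp add: circle_mean_eq_cmean G_def)
  finally show ?thesis .
qed auto

section \<open>The theorem of M. Riesz\<close>

text \<open>With s the modulus of the argument of w, division by \<open>norm w powr p\<close> leaves
  an inequality between 1, cos s and cos (p s). Beyond a threshold angle the term with B suffices,
  below it the term with A.\<close>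

lemma riesz_pointwise:
  fixes p :: real
  assumes p: "1 < p" "p \<le> 2"
  obtains A B where "0 \<le> A" "0 \<le> B"
    "\<And>w. 0 < Re w \<Longrightarrow> norm w powr p \<le> A * Re w powr p - B * Re (w powr of_real p)"
proof -
  \<comment> \<open>The midpoint of pi / (2 p) and pi / 2: large enough that cos (p a) is negative,
    small enough that cos a is positive.\<close>
  define a where "a = (pi / (2 * p) + pi / 2) / 2"
  have "pi / (2 * p) < pi / 2" using p by (simp add: field_simps)
  then have a1: "pi / (2 * p) < a" "a < pi / 2" by (auto simp: a_def)
  have a0: "0 < a" using a1(1) p by (meson divide_pos_pos less_trans mult_pos_pos pi_gt_zero zero_less_numeral zero_less_one)
  have pa: "pi / 2 < p * a" using a1(1) p by (simp add: field_simps)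
  have pa2: "p * a < pi"   proof -
    have "p * a \<le> 2 * a" using p a0 by (intro mult_right_mono) auto
    then show ?thesis using a1 by linarith
  qed
  define c where "c = - cos (p * a)"
  have c: "0 < c" using cos_gt_zero_pi[of "pi - p * a"] pa pa2 by (simp add: c_def)
  define d where "d = cos a powr p"
  have d: "0 < d" using cos_gt_zero_pi[of a] a1 a0 by (simp add: d_def)
  \<comment> \<open>B makes the second term at least 1 from the angle a on; below a, A pays for 1
    and for the largest value B of the subtracted term.\<close>
  define B where "B = 1 / c"
  define A where "A = (1 + B) / d"
  have B: "0 \<le> B" using c by (simp add: B_def)
  have A: "0 \<le> A" using B d by (simp add: A_def)
  have key: "1 \<le> A * cos s powr p - B * cos (p * s)" if s: "0 \<le> s" "s < pi / 2" for s
  proof (cases "a \<le> s")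
    case True
    \<comment> \<open>Here \<open>p \<le> 2\<close> enters: p s does not exceed pi, so cosine still
      decreases there.\<close>
    have "p * s \<le> 2 * s" using p s by (intro mult_right_mono) auto
    then have "p * s \<le> pi" using s by linarith
    then have "cos (p * s) \<le> cos (p * a)"
      using True p a0 by (intro cos_monotone_0_pi_le) auto
    then have "B * c \<le> B * - cos (p * s)"
      using B by (intro mult_left_mono) (auto simp: c_def)
    moreover have "B * c = 1" using c by (simp add: B_def)
    moreover have "0 \<le> A * cos s powr p" using A by simp
    ultimately show ?thesis by simp
  next
    case False
    have "cos a \<le> cos s" using False s a1 by (intro cos_monotone_0_pi_le) auto
    moreover have "0 \<le> cos a" using cos_gt_zero_pi[of a] a1 a0 by auto
    ultimately have "d \<le> cos s powr p" unfolding d_def using p by (intro powr_mono2) auto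
    then have "A * d \<le> A * cos s powr p" using A by (intro mult_left_mono)
    moreover have "A * d = 1 + B" using d by (simp add: A_def)
    moreover have "B * cos (p * s) \<le> B * 1" using B by (intro mult_left_mono) auto
    ultimately show ?thesis by simp
  qed
  have "norm w powr p \<le> A * Re w powr p - B * Re (w powr of_real p)" if w: "0 < Re w" for w
  proof -
    define s where "s = Im (Ln w)"
    have w0: "w \<noteq> 0" using w by auto
    have s: "\<bar>s\<bar> < pi / 2" using w Re_Ln_pos_lt[OF w0] by (simp add: s_def)
    have "Re w = Re (exp (Ln w))" using w0 by simp
    also have "\<dots> = norm w * cos s" unfolding Re_exp using w0 by (simp add: s_def)
    finally have Rw: "Re w = norm w * cos \<bar>s\<bar>" by simp
    have "- (pi / 2) < s" "s < pi / 2" using s by linarith+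
    then have cs: "0 \<le> cos \<bar>s\<bar>" using cos_gt_zero_pi[of s] by simp
    have "Re (w powr of_real p) = exp (p * ln (norm w)) * cos (p * s)"
      using w0 by (simp add: powr_def Re_exp s_def)
    also have "\<dots> = norm w powr p * cos (p * \<bar>s\<bar>)"
      using w0 by (cases "s \<ge> 0") (auto simp: powr_def)
    finally have R2: "Re (w powr of_real p) = norm w powr p * cos (p * \<bar>s\<bar>)" .
    have "norm w powr p * 1 \<le> norm w powr p * (A * cos \<bar>s\<bar> powr p - B * cos (p * \<bar>s\<bar>))"
      using s by (intro mult_left_mono key) auto
    then show ?thesis
      unfolding R2 Rw using cs by (simp add: powr_mult algebra_simps)
  qed
  with A B that show thesis by blast
qed

section \<open>The Szego integral of continuous data on the circle\<close>

definition szego :: "(real \<Rightarrow> complex) \<Rightarrow> complex \<Rightarrow> complex" where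
  "szego h z = cmean (\<lambda>t. h t / (1 - z * cnj (cis t)))"

lemma szego_denominator: "1 - norm z \<le> norm (1 - z * cnj (cis t))"
  using norm_triangle_ineq2[of 1 "z * cnj (cis t)"] by (simp add: norm_mult)

lemma szego_denominator_nz: "norm z < 1 \<Longrightarrow> 1 - z * cnj (cis t) \<noteq> 0"
  using szego_denominator[of z t] by (metis diff_gt_0_iff_gt norm_zero not_le)

lemma continuous_on_szego_integrand:
  "continuous_on UNIV h \<Longrightarrow> norm z < 1 \<Longrightarrow> continuous_on UNIV (\<lambda>t. h t / (1 - z * cnj (cis t)))"
  using szego_denominator_nz[of z] by (intro continuous_intros) auto

lemma szego_add:
  assumes "continuous_on UNIV f" "continuous_on UNIV g" "norm z < 1"
  shows "szego (\<lambda>t. f t + g t) z = szego f z + szego g z"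
  unfolding szego_def add_divide_distrib
  by (intro cmean_add continuous_on_szego_integrand assms)

lemma szego_diff:
  assumes "continuous_on UNIV f" "continuous_on UNIV g" "norm z < 1"
  shows "szego (\<lambda>t. f t - g t) z = szego f z - szego g z"
  unfolding szego_def diff_divide_distrib
  by (intro cmean_diff continuous_on_szego_integrand assms)

lemma szego_cmult:
  assumes "continuous_on UNIV f" "norm z < 1"
  shows "szego (\<lambda>t. c * f t) z = c * szego f z"
  using cmean_cmult[OF continuous_on_szego_integrand[OF assms], of c] by (simp add: szego_def)

lemma szego_holomorphic:
  assumes "continuous_on UNIV h"
  shows "szego h holomorphic_on ball 0 1"
proof -
  have nz: "1 - x * cnj (cis t) \<noteq> 0" if "x \<in> ball 0 1" for x t
    using szego_denominator_nz that by auto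
  have "(\<lambda>z. integral (cbox 0 (2*pi)) (\<lambda>t. h t / (1 - z * cnj (cis t)))) holomorphic_on ball 0 1"
  proof (rule leibniz_rule_holomorphic)
    show "((\<lambda>x. h t / (1 - x * cnj (cis t))) has_field_derivative
            h t * cnj (cis t) / (1 - x * cnj (cis t))\<^sup>2) (at x within ball 0 1)"
      if "x \<in> ball 0 1" for x t
      using nz[OF that, of t]
      by (auto intro!: derivative_eq_intros simp: power2_eq_square)
    show "(\<lambda>t. h t / (1 - x * cnj (cis t))) integrable_on cbox 0 (2 * pi)" if "x \<in> ball 0 1" for x
      using cont_integrable[OF continuous_on_szego_integrand[OF assms]] that by auto
    have "continuous_on (ball 0 1 \<times> cbox 0 (2 * pi)) (\<lambda>x::complex\<times>real. h (snd x))"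
      by (rule continuous_on_compose2[OF assms]) (auto intro!: continuous_intros)
    then show "continuous_on (ball 0 1 \<times> cbox 0 (2 * pi))
        (\<lambda>(x, t). h t * cnj (cis t) / (1 - x * cnj (cis t))\<^sup>2)"
      unfolding case_prod_unfold using nz by (intro continuous_intros) auto
  qed auto
  then have "(\<lambda>z. of_real (1 / (2*pi)) * integral {0..2*pi} (\<lambda>t. h t / (1 - z * cnj (cis t))))
      holomorphic_on ball 0 1"
    by (intro holomorphic_intros) auto
  then show ?thesis
    by (simp add: szego_def[abs_def] cmean_def scaleR_conv_of_real)
qed

text \<open>Twice the Szego kernel minus 1 is the Herglotz kernel. The combination on the left is
  thus the analytic function whose real part is the Poisson integral of u and whose value at 0 is
  real.\<close>

lemma Re_szego_eq_poisson:
  assumes u: "continuous_on UNIV u" and z: "norm z < 1"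
  shows "Re (2 * szego (\<lambda>t. of_real (u t)) z - of_real (cmean u)) = cmean (\<lambda>t. poisson z t * u t)"
proof -
  define g where "g = (\<lambda>t. complex_of_real (u t) / (1 - z * cnj (cis t)))"
  have cu: "continuous_on UNIV (\<lambda>t. complex_of_real (u t))"
    using u by (intro continuous_intros)
  have g: "continuous_on UNIV g"
    unfolding g_def by (intro continuous_on_szego_integrand cu z)
  have pw: "poisson z t * u t = 2 * Re (g t) - u t" for t
  proof -
    have "cis t - z \<noteq> 0" using cis_minus_nz[OF z] .
    define w where "w = 1 / (1 - z * cnj (cis t))"
    have "(cis t + z) / (cis t - z) = 2 * w - 1"
      using \<open>cis t - z \<noteq> 0\<close> unfolding w_def cnj_cis_eq by (simp add: divide_simps)
    then have pz: "poisson z t = 2 * Re w - 1"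
      unfolding poisson_def by simp
    have "g t = of_real (u t) * w"
      by (simp add: g_def w_def)
    then show ?thesis unfolding pz by (simp add: algebra_simps)
  qed
  have "cmean (\<lambda>t. 2 * Re (g t) - u t) = cmean (\<lambda>t. 2 * Re (g t)) - cmean u"
    by (intro cmean_diff continuous_intros g u)
  also have "cmean (\<lambda>t. 2 * Re (g t)) = 2 * Re (cmean g)"
    using cmean_cmult[of "\<lambda>t. Re (g t)" 2] cmean_linear[OF bounded_linear_Re g] g
    by (simp add: continuous_intros)
  finally show ?thesis
    by (simp add: pw szego_def g_def)
qed

lemma cmean_eq_0_imp:
  fixes u :: "real \<Rightarrow> real"
  assumes "continuous_on UNIV u" "\<And>t. 0 \<le> u t" "cmean u = 0" "t \<in> {0..2*pi}"
  shows "u t = 0"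
  using integral_eq_0_iff[of 0 "2*pi" u] assms continuous_on_subset[OF assms(1)]
  by (auto simp: cmean_def)

lemma cmean_cong: "(\<And>t. t \<in> {0..2*pi} \<Longrightarrow> f t = g t) \<Longrightarrow> cmean f = cmean g"
  unfolding cmean_def by (metis integral_cong)

lemma riesz_nonneg:
  fixes p :: real
  assumes p: "1 < p" "p \<le> 2"
  obtains A where "0 \<le> A"
    "\<And>u r. \<lbrakk>continuous_on UNIV u; \<And>t. 0 \<le> u t; 0 \<le> r; r < 1\<rbrakk> \<Longrightarrow>
       cmean (\<lambda>x. norm (2 * szego (\<lambda>t. of_real (u t)) (of_real r * cis x) - of_real (cmean u)) powr p)
         \<le> A * cmean (\<lambda>t. u t powr p)"
proof -
  obtain A B where A: "0 \<le> A" and B: "0 \<le> B"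
    and AB: "\<And>w. 0 < Re w \<Longrightarrow> norm w powr p \<le> A * Re w powr p - B * Re (w powr of_real p)"
    using riesz_pointwise[OF p] by blast
  have "cmean (\<lambda>x. norm (2 * szego (\<lambda>t. of_real (u t)) (of_real r * cis x) - of_real (cmean u)) powr p)
         \<le> A * cmean (\<lambda>t. u t powr p)"
    if u: "continuous_on UNIV u" "\<And>t. 0 \<le> u t" and r: "0 \<le> r" "r < 1" for u r
  \<comment> \<open>If the mean is 0, then u is 0 on the period and F vanishes, outside the domain
    where the power is analytic.\<close>
  proof (cases "cmean u = 0")
    case True
    have u0: "u t = 0" if "t \<in> {0..2*pi}" for t
      using cmean_eq_0_imp[OF u True that] .
    have "szego (\<lambda>t. of_real (u t)) z = cmean (\<lambda>_. 0)" for z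
      unfolding szego_def by (rule cmean_cong) (simp add: u0)
    moreover have "0 \<le> A * cmean (\<lambda>t. u t powr p)"
      using u p A by (intro mult_nonneg_nonneg cmean_nonneg continuous_intros) auto
    ultimately show ?thesis using True p by simp
  next
    case False
    define F where "F = (\<lambda>z. 2 * szego (\<lambda>t. of_real (u t)) z - of_real (cmean u))"
    have cu: "continuous_on UNIV (\<lambda>t. complex_of_real (u t))"
      using u by (intro continuous_intros)
    have F: "F holomorphic_on ball 0 1"
      unfolding F_def by (intro holomorphic_intros szego_holomorphic cu)
    have cF: "continuous_on (ball 0 1) F" using F by (rule holomorphic_on_imp_continuous_on)
    have ReF: "Re (F z) = cmean (\<lambda>t. poisson z t * u t)" if "norm z < 1" for z
      unfolding F_def using Re_szego_eq_poisson[OF u(1) that] .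
    have pos: "0 < Re (F z)" if z: "norm z < 1" for z
    proof (rule ccontr)
      assume "\<not> 0 < Re (F z)"
      have nn: "0 \<le> poisson z t * u t" for t
        using poisson_pos[OF z, of t] u(2)[of t] by simp
      have c: "continuous_on UNIV (\<lambda>t. poisson z t * u t)"
        by (intro continuous_intros z u)
      have "cmean (\<lambda>t. poisson z t * u t) = 0"
        using \<open>\<not> 0 < Re (F z)\<close> ReF[OF z] cmean_nonneg[OF c nn] by linarith
      then have "u t = 0" if "t \<in> {0..2*pi}" for t
        using cmean_eq_0_imp[OF c nn _ that] poisson_pos[OF z, of t] by simp
      then have "cmean u = cmean (\<lambda>_. 0)" by (intro cmean_cong)
      then show False using False by simp
    qed
    define G where "G = (\<lambda>z. F (of_real r * z) powr of_real p)"
    have dF: "(\<lambda>z. F (of_real r * z)) holomorphic_on cball 0 1"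
      using F r by (rule dilate_holomorphic)
    have nr: "norm (of_real r * z) < 1" if "norm z \<le> 1" for z :: complex
    proof -
      have "r * norm z \<le> r * 1" using that r by (intro mult_left_mono) auto
      then show ?thesis using r by (simp add: norm_mult)
    qed
    have G: "G holomorphic_on cball 0 1"
      unfolding G_def
    proof (intro holomorphic_intros dF)
      fix z :: complex assume "z \<in> cball 0 1"
      then have "0 < Re (F (of_real r * z))" using pos nr by auto
      then show "F (of_real r * z) \<notin> \<real>\<^sub>\<le>\<^sub>0" by (auto simp: complex_nonpos_Reals_iff)
    qed
    have cG: "continuous_on (cball 0 1) G" using G by (rule holomorphic_on_imp_continuous_on)
    have cGc: "continuous_on UNIV (\<lambda>x. G (cis x))"
      by (rule continuous_on_compose2[OF cG]) (auto intro!: continuous_intros)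
    have cFc: "continuous_on UNIV (\<lambda>x. F (of_real r * cis x))"
      using r by (intro continuous_on_circle cF) auto
    have G0: "0 \<le> Re (cmean (\<lambda>x. G (cis x)))"
    proof -
      have "cmean (\<lambda>x. G (cis x)) = G 0"
        using cG holomorphic_on_subset[OF G ball_subset_cball] by (rule circle_mean_value)
      also have "\<dots> = of_real (cmean u) powr of_real p"
        using cmean_linear[OF bounded_linear_of_real[where 'a = complex] u(1)]
        by (simp add: G_def F_def szego_def)
      also have "\<dots> = of_real (cmean u powr p)"
        using cmean_nonneg[OF u] by (simp add: powr_of_real)
      finally show ?thesis by simp
    qed
    have posr: "0 < Re (F (of_real r * cis x))" for x
      using pos nr[of "cis x"] by simp
    have "cmean (\<lambda>x. norm (F (of_real r * cis x)) powr p)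
        \<le> cmean (\<lambda>x. A * Re (F (of_real r * cis x)) powr p - B * Re (G (cis x)))"
      using p posr AB[OF posr] unfolding G_def
      by (intro cmean_mono continuous_intros cFc cGc[unfolded G_def]) (auto intro: less_imp_le)
    also have "\<dots> = A * cmean (\<lambda>x. Re (F (of_real r * cis x)) powr p) - B * cmean (\<lambda>x. Re (G (cis x)))"
    proof -
      have c1: "continuous_on UNIV (\<lambda>x. Re (F (of_real r * cis x)) powr p)"
        using p posr by (intro continuous_intros cFc) (auto intro: less_imp_le)
      have c2: "continuous_on UNIV (\<lambda>x. Re (G (cis x)))"
        by (intro continuous_intros cGc)
      show ?thesis
        using cmean_cmult[OF c1, of A] cmean_cmult[OF c2, of B]
        by (subst cmean_diff) (auto intro!: continuous_on_mult_left c1 c2)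
    qed
    also have "cmean (\<lambda>x. Re (G (cis x))) = Re (cmean (\<lambda>x. G (cis x)))"
      by (intro cmean_linear bounded_linear_Re cGc)
    also have "A * cmean (\<lambda>x. Re (F (of_real r * cis x)) powr p) - B * Re (cmean (\<lambda>x. G (cis x)))
        \<le> A * cmean (\<lambda>x. Re (F (of_real r * cis x)) powr p)"
      using mult_nonneg_nonneg[OF B G0] by simp
    also have "cmean (\<lambda>x. Re (F (of_real r * cis x)) powr p)
        = cmean (\<lambda>x. cmean (\<lambda>t. poisson (of_real r * cis x) t * u t) powr p)"
      using ReF nr by simp
    also have "A * \<dots> \<le> A * cmean (\<lambda>t. u t powr p)"
      using A p u r by (intro mult_left_mono cmean_poisson_integral_powr_le) auto
    finally show ?thesis unfolding F_def .
  qed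
  with A that show thesis by blast
qed

lemma powr_add_le:
  fixes x y p :: real
  assumes "0 \<le> x" "0 \<le> y" "0 \<le> p"
  shows "(x + y) powr p \<le> 2 powr p * (x powr p + y powr p)"
proof -
  have "(x + y) powr p \<le> (2 * max x y) powr p" using assms by (intro powr_mono2) auto
  also have "\<dots> = 2 powr p * max x y powr p" using assms by (simp add: powr_mult)
  also have "\<dots> \<le> 2 powr p * (x powr p + y powr p)"
    by (intro mult_left_mono) (auto simp: max_def)
  finally show ?thesis .
qed

text \<open>A quasi-triangle inequality for p-th powers, used in place of the triangle inequality
  for the norm; it avoids p-th roots.\<close>

lemma norm_add_powr_le:
  fixes x y :: "'a::real_normed_vector"
  assumes "0 \<le> p"
  shows "norm (x + y) powr p \<le> 2 powr p * (norm x powr p + norm y powr p)"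
  using powr_mono2[OF assms norm_ge_zero norm_triangle_ineq[of x y]]
    powr_add_le[OF norm_ge_zero[of x] norm_ge_zero[of y] assms] by linarith

lemma norm_diff_powr_le:
  fixes x y :: "'a::real_normed_vector"
  assumes "0 \<le> p"
  shows "norm (x - y) powr p \<le> 2 powr p * (norm x powr p + norm y powr p)"
  using norm_add_powr_le[OF assms, of x "- y"] by simp

text \<open>Complex data split into four nonnegative continuous parts, each dominated by the modulus
  of h. The constant \<open>cmean u\<close> that separates F from twice the Szego integral is
  controlled by Jensen's inequality.\<close>

lemma riesz_le_2:
  fixes p :: real
  assumes p: "1 < p" "p \<le> 2"
  obtains C where "0 \<le> C"
    "\<And>h r. \<lbrakk>continuous_on UNIV h; 0 \<le> r; r < 1\<rbrakk> \<Longrightarrow>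
       cmean (\<lambda>x. norm (szego h (of_real r * cis x)) powr p) \<le> C * cmean (\<lambda>t. norm (h t) powr p)"
proof -
  obtain A where A: "0 \<le> A"
    and Ri: "\<And>u r. \<lbrakk>continuous_on UNIV u; \<And>t. 0 \<le> u t; 0 \<le> r; r < 1\<rbrakk> \<Longrightarrow>
       cmean (\<lambda>x. norm (2 * szego (\<lambda>t. of_real (u t)) (of_real r * cis x) - of_real (cmean u)) powr p)
         \<le> A * cmean (\<lambda>t. u t powr p)"
    using riesz_nonneg[OF p] by blast
  define K where "K = (2::real) powr p"
  have K: "0 \<le> K" by (simp add: K_def)
  have S: "cmean (\<lambda>x. norm (szego (\<lambda>t. of_real (u t)) (of_real r * cis x)) powr p)
         \<le> K * (A + 1) * cmean (\<lambda>t. norm (h t) powr p)"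
    if u: "continuous_on UNIV u" "\<And>t. 0 \<le> u t" "\<And>t. u t \<le> norm (h t)"
      and h: "continuous_on UNIV h" and r: "0 \<le> r" "r < 1"
    for u and h :: "real \<Rightarrow> complex" and r
  proof -
    have cs: "continuous_on UNIV (\<lambda>x. szego (\<lambda>t. of_real (u t)) (of_real r * cis x))"
      using r u by (intro continuous_on_circle holomorphic_on_imp_continuous_on szego_holomorphic continuous_intros) auto
    define m where "m = cmean u"
    have m: "0 \<le> m" unfolding m_def by (intro cmean_nonneg u)
    let ?F = "\<lambda>x. 2 * szego (\<lambda>t. of_real (u t)) (of_real r * cis x) - of_real (cmean u)"
    have "cmean (\<lambda>x. norm (szego (\<lambda>t. of_real (u t)) (of_real r * cis x)) powr p)
        \<le> cmean (\<lambda>x. K * (norm (?F x) powr p + m powr p))"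
    proof (intro cmean_mono continuous_intros cs norm_ge_zero)
      fix x
      have "norm (szego (\<lambda>t. of_real (u t)) (of_real r * cis x)) powr p
          \<le> norm (2 * szego (\<lambda>t. of_real (u t)) (of_real r * cis x)) powr p"
        using p by (intro powr_mono2) (auto simp: norm_mult)
      also have "\<dots> = norm (?F x + of_real m) powr p" by (simp add: m_def)
      also have "\<dots> \<le> K * (norm (?F x) powr p + norm (complex_of_real m) powr p)"
        unfolding K_def using p by (intro norm_add_powr_le) auto
      finally show "norm (szego (\<lambda>t. of_real (u t)) (of_real r * cis x)) powr p
          \<le> K * (norm (?F x) powr p + m powr p)" using m by simp
    qed (use p in auto)
    also have "\<dots> = K * (cmean (\<lambda>x. norm (?F x) powr p) + m powr p)"
    proof -
      have c: "continuous_on UNIV (\<lambda>x. norm (?F x) powr p)"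
        using p by (intro continuous_intros cs) auto
      show ?thesis
        using cmean_add[OF c continuous_on_const[of _ "m powr p"]]
        by (subst cmean_cmult) (auto intro!: continuous_intros c)
    qed
    also have "\<dots> \<le> K * (A * cmean (\<lambda>t. u t powr p) + cmean (\<lambda>t. u t powr p))"
      unfolding m_def using K p u r by (intro mult_left_mono add_mono Ri cmean_powr_le) auto
    also have "\<dots> = K * (A + 1) * cmean (\<lambda>t. u t powr p)" by (simp add: algebra_simps)
    also have "\<dots> \<le> K * (A + 1) * cmean (\<lambda>t. norm (h t) powr p)"
      using K A u h p by (intro mult_left_mono cmean_mono continuous_intros powr_mono2) auto
    finally show ?thesis .
  qed
  \<comment> \<open>One K comes from passing from F to the Szego integral, two from the two levels
    of splitting, and the 4 counts the parts.\<close>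
  have "cmean (\<lambda>x. norm (szego h (of_real r * cis x)) powr p)
      \<le> (4 * K * K * K * (A + 1)) * cmean (\<lambda>t. norm (h t) powr p)"
    if h: "continuous_on UNIV h" and r: "0 \<le> r" "r < 1" for h r
  proof -
    define u1 where "u1 = (\<lambda>t. max 0 (Re (h t)))"
    define u2 where "u2 = (\<lambda>t. max 0 (- Re (h t)))"
    define u3 where "u3 = (\<lambda>t. max 0 (Im (h t)))"
    define u4 where "u4 = (\<lambda>t. max 0 (- Im (h t)))"
    have cu: "continuous_on UNIV u1" "continuous_on UNIV u2" "continuous_on UNIV u3" "continuous_on UNIV u4"
      unfolding u1_def u2_def u3_def u4_def by (intro continuous_intros h)+
    have nu: "0 \<le> u1 t" "0 \<le> u2 t" "0 \<le> u3 t" "0 \<le> u4 t" for t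
      by (auto simp: u1_def u2_def u3_def u4_def)
    have lu: "u1 t \<le> norm (h t)" "u2 t \<le> norm (h t)" "u3 t \<le> norm (h t)" "u4 t \<le> norm (h t)" for t
      using abs_Re_le_cmod[of "h t"] abs_Im_le_cmod[of "h t"]
      by (auto simp: u1_def u2_def u3_def u4_def)
    let ?S = "\<lambda>u z. szego (\<lambda>t. of_real (u t)) z"
    let ?c = "\<lambda>u t. complex_of_real (u t)"
    have cc: "continuous_on UNIV (?c u1)" "continuous_on UNIV (?c u2)" "continuous_on UNIV (?c u3)" "continuous_on UNIV (?c u4)"
      by (intro continuous_intros cu)+
    have hd: "h = (\<lambda>t. (?c u1 t - ?c u2 t) + \<i> * (?c u3 t - ?c u4 t))"
      by (rule ext) (auto simp: complex_eq_iff u1_def u2_def u3_def u4_def)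
    have dec: "szego h z = (?S u1 z - ?S u2 z) + \<i> * (?S u3 z - ?S u4 z)" if z: "norm z < 1" for z
      unfolding hd using cc z
      by (subst szego_add szego_diff szego_cmult, (intro continuous_intros cc z)+)+ simp
    have cs: "continuous_on UNIV (\<lambda>x. ?S u (of_real r * cis x))" if "continuous_on UNIV u" for u
      using r that by (intro continuous_on_circle holomorphic_on_imp_continuous_on szego_holomorphic continuous_intros) auto
    have ch: "continuous_on UNIV (\<lambda>x. szego h (of_real r * cis x))"
      using r h by (intro continuous_on_circle holomorphic_on_imp_continuous_on szego_holomorphic) auto
    define n where "n = (\<lambda>u x. norm (?S u (of_real r * cis x)) powr p)"
    have cn: "continuous_on UNIV (n u)" if "continuous_on UNIV u" for u
      unfolding n_def using p by (intro continuous_intros cs that) auto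
    have pw: "norm (szego h (of_real r * cis x)) powr p \<le> K * K * (n u1 x + n u2 x + n u3 x + n u4 x)" for x
    proof -
      let ?z = "complex_of_real r * cis x"
      have z: "norm ?z < 1" using r by (simp add: norm_mult)
      have "norm (szego h ?z) powr p \<le> K * (norm (?S u1 ?z - ?S u2 ?z) powr p + norm (\<i> * (?S u3 ?z - ?S u4 ?z)) powr p)"
        unfolding dec[OF z] K_def using p by (intro norm_add_powr_le) auto
      also have "\<dots> \<le> K * (K * (n u1 x + n u2 x) + K * (n u3 x + n u4 x))"
        unfolding n_def norm_mult norm_ii mult_1
        using p by (intro mult_left_mono add_mono norm_diff_powr_le[of p, folded K_def] K) auto
      finally show ?thesis by (simp add: algebra_simps)
    qed
    have "cmean (\<lambda>x. norm (szego h (of_real r * cis x)) powr p)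
       \<le> cmean (\<lambda>x. K * K * (n u1 x + n u2 x + n u3 x + n u4 x))"
      using p by (intro cmean_mono pw continuous_intros ch cn cu) auto
    also have "\<dots> = K * K * (cmean (n u1) + cmean (n u2) + cmean (n u3) + cmean (n u4))"
      by (subst cmean_cmult cmean_add, (intro continuous_intros cn cu)+)+ simp
    also have "\<dots> \<le> K * K * (K * (A + 1) * cmean (\<lambda>t. norm (h t) powr p) + K * (A + 1) * cmean (\<lambda>t. norm (h t) powr p)
         + K * (A + 1) * cmean (\<lambda>t. norm (h t) powr p) + K * (A + 1) * cmean (\<lambda>t. norm (h t) powr p))"
      unfolding n_def using K by (intro mult_left_mono add_mono S cu nu lu h r) auto
    finally show ?thesis by (simp add: algebra_simps)
  qed
  moreover have "0 \<le> 4 * K * K * K * (A + 1)" using K A by simp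
  ultimately show thesis using that by blast
qed

text \<open>Conjugating the kernel exchanges its two angles, so by Fubini the Szego operator at
  radius r is its own adjoint.\<close>

lemma szego_duality:
  assumes h: "continuous_on UNIV h" and g: "continuous_on UNIV g" and r: "0 \<le> r" "r < 1"
  shows "cmean (\<lambda>x. szego h (of_real r * cis x) * g x)
       = cmean (\<lambda>t. h t * cnj (szego (\<lambda>x. cnj (g x)) (of_real r * cis t)))"
proof -
  have nr: "norm (complex_of_real r * cis x) < 1" for x using r by (simp add: norm_mult)
  have nz: "1 - complex_of_real r * cis x * cnj (cis t) \<noteq> 0" for x t
    using szego_denominator_nz[OF nr] .
  have ch: "continuous_on UNIV (\<lambda>p::real\<times>real. h (snd p))"
    by (rule continuous_on_compose2[OF h]) (auto intro!: continuous_intros)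
  have cg: "continuous_on UNIV (\<lambda>p::real\<times>real. g (fst p))"
    by (rule continuous_on_compose2[OF g]) (auto intro!: continuous_intros)
  have c: "continuous_on UNIV (\<lambda>(x, t). h t / (1 - of_real r * cis x * cnj (cis t)) * g x)"
    unfolding case_prod_unfold using nz by (intro continuous_intros ch cg) auto
  have c1: "continuous_on UNIV (\<lambda>x. g x / (1 - of_real r * cis x * cnj (cis t)))" for t
    using nz by (intro continuous_intros g) auto
  have "cmean (\<lambda>x. szego h (of_real r * cis x) * g x)
      = cmean (\<lambda>x. cmean (\<lambda>t. h t / (1 - of_real r * cis x * cnj (cis t)) * g x))"
    unfolding szego_def
    by (subst cmean_cmult_right) (auto intro!: continuous_on_szego_integrand h nr)
  also have "\<dots> = cmean (\<lambda>t. cmean (\<lambda>x. h t / (1 - of_real r * cis x * cnj (cis t)) * g x))"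
    by (rule cmean_swap[OF c])
  also have "\<dots> = cmean (\<lambda>t. h t * cmean (\<lambda>x. g x / (1 - of_real r * cis x * cnj (cis t))))"
    using cmean_cmult[OF c1] by simp
  also have "\<dots> = cmean (\<lambda>t. h t * cnj (szego (\<lambda>x. cnj (g x)) (of_real r * cis t)))"
  proof -
    have "cnj (szego (\<lambda>x. cnj (g x)) (of_real r * cis t)) = cmean (\<lambda>x. g x / (1 - of_real r * cis x * cnj (cis t)))" for t
    proof -
      have "cnj (szego (\<lambda>x. cnj (g x)) (of_real r * cis t))
         = cmean (\<lambda>x. cnj (cnj (g x) / (1 - of_real r * cis t * cnj (cis x))))"
        unfolding szego_def
        by (rule cmean_linear[OF bounded_linear_cnj, symmetric]) (intro continuous_on_szego_integrand continuous_intros g nr)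
      then show ?thesis by (simp add: mult_ac)
    qed
    then show ?thesis by simp
  qed
  finally show ?thesis .
qed

text \<open>For p > 2 the dual exponent q lies between 1 and 2. Pairing F with its dual function
  yields the p-th mean of F; the adjoint moves the Szego operator onto the dual function, where the
  bound for q applies.\<close>

theorem riesz:
  fixes p :: real
  assumes p: "1 < p"
  obtains C where "0 \<le> C"
    "\<And>h r. \<lbrakk>continuous_on UNIV h; 0 \<le> r; r < 1\<rbrakk> \<Longrightarrow>
       cmean (\<lambda>x. norm (szego h (of_real r * cis x)) powr p) \<le> C * cmean (\<lambda>t. norm (h t) powr p)"
proof (cases "p \<le> 2")
  case True
  then show thesis using riesz_le_2[OF p] that by blast
next
  case False
  define q where "q = p / (p - 1)"
  have q: "1 < q" "q \<le> 2" "1 / p + 1 / q = 1" "(p - 1) * q = p"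
    using False by (auto simp: q_def field_simps)
  obtain C where C: "0 \<le> C" and Ri: "\<And>h r. \<lbrakk>continuous_on UNIV h; 0 \<le> r; r < 1\<rbrakk> \<Longrightarrow>
       cmean (\<lambda>x. norm (szego h (of_real r * cis x)) powr q) \<le> C * cmean (\<lambda>t. norm (h t) powr q)"
    using riesz_le_2[OF q(1,2)] by blast
  \<comment> \<open>A weight for Young's inequality, chosen so that at most half of Y survives on
    the right: C / (2 C + 1) is at most 1 / 2.\<close>
  define L where "L = (2 * C + 1) powr (1 / q)"
  have L: "0 < L" using C by (simp add: L_def)
  have Lq: "L powr q = 2 * C + 1" using C q by (simp add: L_def powr_powr)
  have "cmean (\<lambda>x. norm (szego h (of_real r * cis x)) powr p) \<le> (2 * L powr p) * cmean (\<lambda>t. norm (h t) powr p)"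
    if h: "continuous_on UNIV h" and r: "0 \<le> r" "r < 1" for h r
  proof -
    define F where "F = (\<lambda>x. szego h (of_real r * cis x))"
    have cF: "continuous_on UNIV F"
      unfolding F_def using r h by (intro continuous_on_circle holomorphic_on_imp_continuous_on szego_holomorphic) auto
    \<comment> \<open>The extremal function of the duality between p and q: both
      \<open>F x * g x\<close> and \<open>norm (g x) powr q\<close> equal
      \<open>norm (F x) powr p\<close>.\<close>
    define g where "g = (\<lambda>x. cnj (F x) * of_real (norm (F x) powr (p - 2)))"
    have g: "continuous_on UNIV g"
      unfolding g_def using False by (intro continuous_intros cF) auto
    have Fg: "F x * g x = of_real (norm (F x) powr p)" for x
    proof -
      have "F x * g x = of_real ((norm (F x))\<^sup>2 * norm (F x) powr (p - 2))"
        unfolding g_def by (simp only: of_real_mult complex_norm_square mult.assoc)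
      also have "(norm (F x))\<^sup>2 * norm (F x) powr (p - 2) = norm (F x) powr p"
        by (cases "F x = 0") (auto simp: powr_diff powr_numeral)
      finally show ?thesis .
    qed
    have ng: "norm (g x) powr q = norm (F x) powr p" for x
    proof -
      have "norm (g x) = norm (F x) powr (p - 1)"
        using powr_mult_base[of "norm (F x)" "p - 2"] by (simp add: g_def norm_mult)
      then show ?thesis by (simp add: powr_powr q)
    qed
    define S where "S = (\<lambda>t. szego (\<lambda>x. cnj (g x)) (of_real r * cis t))"
    have cS: "continuous_on UNIV S"
      unfolding S_def using r g by (intro continuous_on_circle holomorphic_on_imp_continuous_on szego_holomorphic continuous_intros) auto
    define X where "X = cmean (\<lambda>t. norm (h t) powr p)"
    define Y where "Y = cmean (\<lambda>x. norm (F x) powr p)"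
    have cX: "continuous_on UNIV (\<lambda>t. norm (h t) powr p)" using p by (intro continuous_intros h) auto
    have cY: "continuous_on UNIV (\<lambda>t. norm (F t) powr p)" using p by (intro continuous_intros cF) auto
    have cSq: "continuous_on UNIV (\<lambda>t. norm (S t) powr q)" using q by (intro continuous_intros cS) auto
    have Y0: "0 \<le> Y" unfolding Y_def by (intro cmean_nonneg cY) auto
    have "complex_of_real Y = cmean (\<lambda>x. F x * g x)"
      unfolding Fg Y_def by (rule cmean_linear[OF bounded_linear_of_real cY, symmetric])
    also have "\<dots> = cmean (\<lambda>t. h t * cnj (S t))"
      unfolding F_def S_def by (rule szego_duality[OF h g r])
    finally have "Y = norm (cmean (\<lambda>t. h t * cnj (S t)))"
      using Y0 by (metis abs_of_nonneg norm_of_real)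
    also have "\<dots> \<le> cmean (\<lambda>t. norm (h t * cnj (S t)))"
      by (intro norm_cmean_le continuous_intros h cS)
    also have "\<dots> \<le> cmean (\<lambda>t. L powr p * norm (h t) powr p + (1 / (2 * C + 1)) * norm (S t) powr q)"
    proof (intro cmean_mono continuous_intros h cS cX cSq)
      fix t
      have "norm (h t * cnj (S t)) = (L * norm (h t)) * (norm (S t) / L)"
        using L by (simp add: norm_mult)
      also have "\<dots> \<le> (L * norm (h t)) powr p / p + (norm (S t) / L) powr q / q"
        using p q L by (intro Youngs_inequality) auto
      also have "\<dots> \<le> (L * norm (h t)) powr p / 1 + (norm (S t) / L) powr q / 1"
        using p q by (intro add_mono divide_left_mono) auto
      also have "\<dots> = L powr p * norm (h t) powr p + (1 / (2 * C + 1)) * norm (S t) powr q"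
        using L Lq by (simp add: powr_mult powr_divide)
      finally show "norm (h t * cnj (S t)) \<le> L powr p * norm (h t) powr p + (1 / (2 * C + 1)) * norm (S t) powr q" .
    qed (use p q in auto)
    also have "\<dots> = L powr p * X + (1 / (2 * C + 1)) * cmean (\<lambda>t. norm (S t) powr q)"
      unfolding X_def cmean_cmult[OF cX, symmetric] cmean_cmult[OF cSq, symmetric]
      by (intro cmean_add continuous_on_mult_left cX cSq)
    also have "\<dots> \<le> L powr p * X + (1 / (2 * C + 1)) * (C * Y)"
    proof -
      have "cmean (\<lambda>t. norm (S t) powr q) \<le> C * cmean (\<lambda>x. norm (cnj (g x)) powr q)"
        unfolding S_def using r g by (intro Ri continuous_intros) auto
      then show ?thesis using C by (intro add_left_mono mult_left_mono) (auto simp: ng Y_def)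
    qed
    also have "(1 / (2 * C + 1)) * (C * Y) \<le> Y / 2"
    proof -
      have "C / (2 * C + 1) \<le> 1 / 2" using C by (simp add: field_simps)
      then have "C / (2 * C + 1) * Y \<le> 1 / 2 * Y" using Y0 by (rule mult_right_mono)
      then show ?thesis by simp
    qed
    \<comment> \<open>Half of Y is absorbed on the left; this is legitimate since Y is the mean of a
      continuous function on an interior circle, hence finite.\<close>
    finally have "Y \<le> 2 * L powr p * X" by simp
    then show ?thesis by (simp add: X_def Y_def F_def)
  qed
  moreover have "0 \<le> 2 * L powr p" by simp
  ultimately show thesis using that by blast
qed

section \<open>Density of Cauchy kernels\<close>

lemma powr_midpoint_less:
  fixes x y p :: real
  assumes p: "1 < p" and xy: "0 \<le> x" "x < y"
  shows "2 * ((x + y) / 2) powr p < x powr p + y powr p"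
proof -
  define m where "m = (x + y) / 2"
  have m: "x < m" "m < y" "0 < m" using xy by (auto simp: m_def)
  have D: "((\<lambda>t. t powr p) has_real_derivative p * t powr (p - 1)) (at t)" if "0 < t" for t
    using that by (auto intro!: derivative_eq_intros)
  have c: "continuous_on S (\<lambda>t. t powr p)" if "S \<subseteq> {0..}" for S :: "real set"
    using p that by (intro continuous_intros) auto
  \<comment> \<open>The chord slopes over the two halves are derivatives at points on either side of
    m, and the derivative is strictly increasing.\<close>
  obtain l u where u: "m < u" "u < y" "y powr p - m powr p = (y - m) * l"
      and l: "((\<lambda>t. t powr p) has_real_derivative l) (at u)"
  proof (rule exE[OF MVT[of m y "\<lambda>t. t powr p"]])
    show "(\<lambda>t. t powr p) differentiable (at t)" if "m < t" "t < y" for t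
      using D[of t] that m by (auto simp: real_differentiable_def)
  qed (use m c[of "{m..y}"] that in auto)
  obtain l' v where v: "x < v" "v < m" "m powr p - x powr p = (m - x) * l'"
      and l': "((\<lambda>t. t powr p) has_real_derivative l') (at v)"
  proof (rule exE[OF MVT[of x m "\<lambda>t. t powr p"]])
    show "(\<lambda>t. t powr p) differentiable (at t)" if "x < t" "t < m" for t
      using D[of t] that xy by (auto simp: real_differentiable_def)
  qed (use m xy c[of "{x..m}"] that in auto)
  have "l = p * u powr (p - 1)" "l' = p * v powr (p - 1)"
    using DERIV_unique[OF l D] DERIV_unique[OF l' D] u v m xy by auto
  moreover have "v powr (p - 1) < u powr (p - 1)"
    using u v xy p by (intro powr_less_mono2) auto
  ultimately have "l' < l" using p by simp
  then have "(m - x) * l' < (m - x) * l" using m by (intro mult_strict_left_mono) auto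
  moreover have "y - m = m - x" by (simp add: m_def field_simps)
  ultimately show ?thesis using u(3) v(3) by (simp add: m_def[symmetric])
qed

lemma powr_midpoint_le:
  fixes x y p :: real
  assumes p: "1 < p" and xy: "0 \<le> x" "0 \<le> y"
  shows "2 * ((x + y) / 2) powr p \<le> x powr p + y powr p"
  using powr_midpoint_less[OF p, of x y] powr_midpoint_less[OF p, of y x] xy
  by (cases x y rule: linorder_cases) (auto simp: add.commute)

text \<open>The convexity defect at a midpoint. Integrated over a circle it compares the p-th means
  of two functions with that of their average.\<close>

definition midpoint_gap :: "real \<Rightarrow> complex \<Rightarrow> complex \<Rightarrow> real" where
  "midpoint_gap p a b = (norm a powr p + norm b powr p) / 2 - norm ((a + b) / 2) powr p"

lemma norm_midpoint_powr_le:
  assumes "1 < p"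
  shows "norm ((a + b) / 2 :: complex) powr p \<le> ((norm a + norm b) / 2) powr p"
  using assms norm_triangle_ineq[of a b] by (intro powr_mono2) (auto simp: norm_divide)

lemma midpoint_gap_nonneg: "1 < p \<Longrightarrow> 0 \<le> midpoint_gap p a b"
  using norm_midpoint_powr_le[of p a b] powr_midpoint_le[of p "norm a" "norm b"]
  by (simp add: midpoint_gap_def)

text \<open>A vanishing gap would force two equalities: strict convexity of the real power yields
  equal moduli, and equality in the triangle inequality yields equal directions.\<close>

lemma midpoint_gap_pos:
  assumes p: "1 < p" and "a \<noteq> b"
  shows "0 < midpoint_gap p a b"
proof (rule ccontr)
  assume "\<not> 0 < midpoint_gap p a b"
  then have z: "norm a powr p + norm b powr p \<le> 2 * norm ((a + b) / 2) powr p"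
    by (simp add: midpoint_gap_def)
  have n1: "norm a = norm b"
  proof (rule ccontr)
    assume "norm a \<noteq> norm b"
    then have "2 * ((norm a + norm b) / 2) powr p < norm a powr p + norm b powr p"
      using powr_midpoint_less[OF p, of "norm a" "norm b"] powr_midpoint_less[OF p, of "norm b" "norm a"]
      by (cases "norm a" "norm b" rule: linorder_cases) (auto simp: add.commute)
    then show False using z norm_midpoint_powr_le[OF p, of a b] by linarith
  qed
  have "norm a powr p \<le> norm ((a + b) / 2) powr p" using z n1 by simp
  then have "norm a \<le> norm ((a + b) / 2)"
    using p powr_less_mono2[of p "norm ((a + b) / 2)" "norm a"] by (meson norm_ge_zero not_le less_trans zero_less_one)
  then have "norm (a + b) = norm a + norm b"
    using norm_triangle_ineq[of a b] n1 by (simp add: norm_divide)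
  then have "norm a *\<^sub>R b = norm b *\<^sub>R a"
    by (simp only: norm_triangle_eq)
  then have "a = b \<or> norm a = 0" using n1 by auto
  then show False using n1 assms(2) by auto
qed

lemma midpoint_gap_scale:
  assumes "0 < t" "1 < p"
  shows "midpoint_gap p (of_real t * a) (of_real t * b) = t powr p * midpoint_gap p a b"
proof -
  have eq: "(of_real t * a + of_real t * b) / 2 = of_real t * ((a + b) / 2)"
    by (simp add: algebra_simps)
  have nt: "norm (of_real t * z) powr p = t powr p * norm z powr p" for z :: complex
    using assms by (simp add: norm_mult powr_mult)
  show ?thesis
    unfolding midpoint_gap_def eq nt by (simp add: right_diff_distrib distrib_left add_divide_distrib)
qed

text \<open>By homogeneity only pairs with \<open>norm a powr p + norm b powr p = 1\<close> matter.
  Those with a small difference are covered by the term with e; the others form a compact set on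
  which the gap has a positive minimum.\<close>

lemma uniform_convexity:
  fixes p e :: real
  assumes p: "1 < p" and e: "0 < e"
  obtains K where "0 \<le> K"
    "\<And>a b :: complex. norm (a - b) powr p \<le> e * (norm a powr p + norm b powr p) + K * midpoint_gap p a b"
proof -
  have p0: "0 < p" using p by simp
  define S where "S = {(a::complex, b::complex). norm a powr p + norm b powr p = 1 \<and> e \<le> norm (a - b) powr p}"
  have le1: "x \<le> 1" if "x powr p \<le> 1" "0 \<le> x" for x
    by (rule ccontr) (use powr_less_mono2[OF p0, of 1 x] that in auto)
  have "S \<subseteq> cball 0 1 \<times> cball 0 1"
  proof (clarsimp simp: S_def)
    fix a b :: complex assume "norm a powr p + norm b powr p = 1"
    then have "norm a powr p \<le> 1" "norm b powr p \<le> 1"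
      using powr_ge_zero[of "norm a" p] powr_ge_zero[of "norm b" p] by linarith+
    then show "norm a \<le> 1 \<and> norm b \<le> 1" using le1 by auto
  qed
  then have bS: "bounded S"
    by (rule bounded_subset[rotated]) (intro bounded_Times bounded_cball)
  have cn: "continuous_on UNIV (\<lambda>x::complex\<times>complex. norm (g x) powr p)"
    if "continuous_on UNIV g" for g :: "complex \<times> complex \<Rightarrow> complex"
    using p0 by (intro continuous_intros that) auto
  have "S = {x. norm (fst x) powr p + norm (snd x) powr p = 1} \<inter> {x. e \<le> norm (fst x - snd x) powr p}"
    by (auto simp: S_def)
  also have "closed \<dots>"
    by (intro closed_Int closed_Collect_eq closed_Collect_le continuous_intros cn norm_ge_zero p0)
  finally have cS: "compact S" using bS by (simp add: compact_eq_bounded_closed)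
  have cg: "continuous_on S (\<lambda>x. midpoint_gap p (fst x) (snd x))"
    unfolding midpoint_gap_def
    by (rule continuous_on_subset[of UNIV]) (auto intro!: continuous_intros p0)
  obtain m where m: "0 < m" "\<And>a b. (a, b) \<in> S \<Longrightarrow> m \<le> midpoint_gap p a b"
  \<comment> \<open>For large e no normalised pair is that far apart, and any positive m
    serves.\<close>
  proof (cases "S = {}")
    case True
    then show thesis using that[of 1] by auto
  next
    case False
    then obtain x where x: "x \<in> S" "\<And>y. y \<in> S \<Longrightarrow> midpoint_gap p (fst x) (snd x) \<le> midpoint_gap p (fst y) (snd y)"
      using continuous_attains_inf[OF cS False cg] by blast
    have "fst x \<noteq> snd x" using x(1) e by (auto simp: S_def)
    then show thesis using that[of "midpoint_gap p (fst x) (snd x)"] midpoint_gap_pos[OF p] x(2) by auto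
  qed
  \<comment> \<open>On S the p-th power of the difference is at most \<open>2 powr p\<close>, while
    the gap is at least m.\<close>
  define K where "K = 2 powr p / m"
  have K: "0 \<le> K" using m by (simp add: K_def)
  have unit: "norm (a - b) powr p \<le> e + K * midpoint_gap p a b"
    if ab: "norm a powr p + norm b powr p = 1" for a b
  proof (cases "e \<le> norm (a - b) powr p")
    case True
    then have "m \<le> midpoint_gap p a b" using m(2) ab by (simp add: S_def)
    then have "K * m \<le> K * midpoint_gap p a b" using K by (intro mult_left_mono)
    moreover have "norm (a - b) powr p \<le> 2 powr p"
      using norm_diff_powr_le[of p a b] ab p0 by simp
    moreover have "K * m = 2 powr p" using m by (simp add: K_def)
    ultimately show ?thesis using e by linarith
  next
    case False
    then show ?thesis using mult_nonneg_nonneg[OF K midpoint_gap_nonneg[OF p]] by (smt (verit))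
  qed
  have "norm (a - b) powr p \<le> e * (norm a powr p + norm b powr p) + K * midpoint_gap p a b" for a b
  proof (cases "a = 0 \<and> b = 0")
    case True
    then show ?thesis using p0 by (simp add: midpoint_gap_def)
  next
    case False
    define s where "s = norm a powr p + norm b powr p"
    have s: "0 < s" using False by (auto simp: s_def add_pos_nonneg add_nonneg_pos)
    define t where "t = s powr (1 / p)"
    have t: "0 < t" "t powr p = s" using s p0 by (auto simp: t_def powr_powr)
    define a' b' where "a' = a / of_real t" and "b' = b / of_real t"
    have ab: "a = of_real t * a'" "b = of_real t * b'" using t by (auto simp: a'_def b'_def)
    have nt: "norm (of_real t * z) powr p = s * norm z powr p" for z :: complex
      using t by (simp add: norm_mult powr_mult)
    have "s * (norm a' powr p + norm b' powr p) = s"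
      unfolding distrib_left nt[symmetric] ab[symmetric] by (simp add: s_def)
    then have "norm a' powr p + norm b' powr p = 1" using s by simp
    then have "s * norm (a' - b') powr p \<le> s * (e + K * midpoint_gap p a' b')"
      using s by (intro mult_left_mono unit) auto
    moreover have "s * norm (a' - b') powr p = norm (a - b) powr p"
      using nt[of "a' - b'"] by (simp add: ab right_diff_distrib)
    moreover have "midpoint_gap p a b = s * midpoint_gap p a' b'"
      using midpoint_gap_scale[OF t(1) p, of a' b'] t by (simp add: ab)
    ultimately show ?thesis by (simp add: s_def[symmetric] algebra_simps)
  qed
  with K that show thesis by blast
qed

text \<open>M bounds the p-th power of the norm. An explicit bound lets estimates compose without
  boundedness conditions for a supremum.\<close>

definition hp_le :: "real \<Rightarrow> (complex \<Rightarrow> complex) \<Rightarrow> real \<Rightarrow> bool" where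
  "hp_le p f M \<longleftrightarrow> f holomorphic_on ball 0 1 \<and> (\<forall>r. 0 \<le> r \<and> r < 1 \<longrightarrow> circle_mean p f r \<le> M)"

lemma in_Hp_iff_hp_le: "in_Hp p f \<longleftrightarrow> (\<exists>M. hp_le p f M)"
  unfolding in_Hp_def hp_le_def bdd_above_def by fastforce

lemma hp_le_mono: "hp_le p f M \<Longrightarrow> M \<le> N \<Longrightarrow> hp_le p f N"
  unfolding hp_le_def by fastforce

lemma continuous_on_holomorphic_circle:
  assumes "f holomorphic_on ball 0 1" "0 \<le> r" "r < 1"
  shows "continuous_on UNIV (\<lambda>t. f (complex_of_real r * cis t))"
  using assms by (intro continuous_on_circle holomorphic_on_imp_continuous_on) auto

lemma continuous_on_circle_powr:
  assumes "f holomorphic_on ball 0 1" "0 \<le> r" "r < 1" "0 < p"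
  shows "continuous_on UNIV (\<lambda>t. norm (f (complex_of_real r * cis t)) powr p)"
  using assms by (intro continuous_intros continuous_on_holomorphic_circle) auto

lemma circle_mean_nonneg:
  assumes "f holomorphic_on ball 0 1" "0 \<le> r" "r < 1" "0 < p"
  shows "0 \<le> circle_mean p f r"
  unfolding circle_mean_eq_cmean using assms
  by (intro cmean_nonneg continuous_on_circle_powr) auto

text \<open>Serves sums, differences and multiplication by a bounded function alike, since each has
  a pointwise bound of this shape.\<close>

lemma hp_le_dominated:
  assumes h: "h holomorphic_on ball 0 1" and p: "0 < p"
    and f: "hp_le p f M" and g: "hp_le p g N" and c: "0 \<le> c"
    and le: "\<And>z. norm z < 1 \<Longrightarrow> norm (h z) powr p \<le> c * (norm (f z) powr p + norm (g z) powr p)"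
  shows "hp_le p h (c * (M + N))"
  unfolding hp_le_def
proof (intro conjI allI impI h)
  fix r :: real assume "0 \<le> r \<and> r < 1"
  then have r: "0 \<le> r" "r < 1" by auto
  have cf: "continuous_on UNIV (\<lambda>t. norm (f (complex_of_real r * cis t)) powr p)"
    and cg: "continuous_on UNIV (\<lambda>t. norm (g (complex_of_real r * cis t)) powr p)"
    and ch: "continuous_on UNIV (\<lambda>t. norm (h (complex_of_real r * cis t)) powr p)"
    using r p f g h by (intro continuous_on_circle_powr; auto simp: hp_le_def)+
  have "circle_mean p h r \<le> cmean (\<lambda>t. c * (norm (f (of_real r * cis t)) powr p + norm (g (of_real r * cis t)) powr p))"
    unfolding circle_mean_eq_cmean using r
    by (intro cmean_mono ch continuous_on_mult_left continuous_on_add cf cg le) (simp add: norm_mult)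
  also have "\<dots> = c * (circle_mean p f r + circle_mean p g r)"
    unfolding circle_mean_eq_cmean cmean_add[OF cf cg, symmetric]
    by (intro cmean_cmult continuous_on_add cf cg)
  also have "\<dots> \<le> c * (M + N)"
    using f g r c by (intro mult_left_mono add_mono) (auto simp: hp_le_def)
  finally show "circle_mean p h r \<le> c * (M + N)" .
qed

lemma hp_le_add:
  assumes "hp_le p f M" "hp_le p g N" "0 < p"
  shows "hp_le p (\<lambda>z. f z + g z) (2 powr p * (M + N))"
  using assms by (intro hp_le_dominated[of _ p f M g N] norm_add_powr_le)
    (auto intro!: holomorphic_intros simp: hp_le_def)

lemma hp_le_diff:
  assumes "hp_le p f M" "hp_le p g N" "0 < p"
  shows "hp_le p (\<lambda>z. f z - g z) (2 powr p * (M + N))"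
  using assms by (intro hp_le_dominated[of _ p f M g N] norm_diff_powr_le)
    (auto intro!: holomorphic_intros simp: hp_le_def)

lemma hp_le_bounded:
  assumes "f holomorphic_on ball 0 1" "\<And>z. norm z < 1 \<Longrightarrow> norm (f z) \<le> c" "0 < p"
  shows "hp_le p f (c powr p)"
proof -
  have "circle_mean p f r \<le> cmean (\<lambda>t. c powr p)" if "0 \<le> r" "r < 1" for r
    unfolding circle_mean_eq_cmean using assms that
    by (intro cmean_mono continuous_on_circle_powr continuous_intros powr_mono2) (auto simp: norm_mult)
  then show ?thesis using assms by (simp add: hp_le_def)
qed

lemma hp_le_mult:
  assumes B: "in_Hinf_ball B" and f: "hp_le p f M" and p: "0 < p"
  shows "hp_le p (\<lambda>z. B z * f z) M"
proof -
  have "norm (B z * f z) powr p \<le> 1 * (norm (f z) powr p + norm (0::complex) powr p)" if "norm z < 1" for z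
    using B that p mult_right_mono[of "norm (B z)" 1 "norm (f z)"]
    by (auto simp: in_Hinf_ball_def norm_mult intro!: powr_mono2)
  moreover have "hp_le p (\<lambda>_. 0) 0"
    using hp_le_bounded[of "\<lambda>_. 0" 0 p] p by auto
  ultimately have "hp_le p (\<lambda>z. B z * f z) (1 * (M + 0))"
    using B f p by (intro hp_le_dominated[of _ p f M "\<lambda>_. 0" 0])
      (auto intro!: holomorphic_intros simp: hp_le_def in_Hinf_ball_def)
  then show ?thesis by simp
qed

text \<open>Identities between Toeplitz operators are proved on the disc only, and
  \<open>hp_le\<close> looks nowhere else; this is how they enter norm estimates.\<close>

lemma hp_le_cong:
  assumes "hp_le p f M" "\<And>z. norm z < 1 \<Longrightarrow> f z = g z"
  shows "hp_le p g M"
proof -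
  have "circle_mean p g r = circle_mean p f r" if "0 \<le> r" "r < 1" for r
    unfolding circle_mean_eq_cmean using assms(2) that by (simp add: norm_mult)
  moreover have "g holomorphic_on ball 0 1"
    using holomorphic_transform[of f "ball 0 1" g] assms by (auto simp: hp_le_def)
  ultimately show ?thesis using assms(1) by (simp add: hp_le_def)
qed

lemma Hp_norm_le:
  assumes "hp_le p f M" "0 < p"
  shows "Hp_norm p f \<le> M powr (1 / p)"
  unfolding Hp_norm_def
proof (rule powr_mono2)
  have bdd: "bdd_above (circle_mean p f ` {0..<1})"
    by (rule bdd_aboveI2[of _ _ M]) (use assms(1) in \<open>auto simp: hp_le_def\<close>)
  show "(SUP r\<in>{0..<1}. circle_mean p f r) \<le> M"
    using assms(1) by (intro cSUP_least) (auto simp: hp_le_def)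
  have "0 \<le> circle_mean p f 0" using circle_mean_nonneg[of f 0 p] assms by (auto simp: hp_le_def)
  also have "\<dots> \<le> (SUP r\<in>{0..<1}. circle_mean p f r)" using bdd by (intro cSUP_upper) auto
  finally show "0 \<le> (SUP r\<in>{0..<1}. circle_mean p f r)" .
qed (use assms in auto)

text \<open>With \<open>M\<close> the supremum of the circle means of \<open>f\<close>, those of the dilate are at most \<open>M\<close> too, while
  those of the midpoint come close to \<open>M\<close>; uniform convexity then makes the difference small.\<close>

lemma dilate_tendsto:
  assumes p: "1 < p" and f: "in_Hp p f" and e: "0 < e"
  obtains \<rho> where "0 \<le> \<rho>" "\<rho> < 1" "hp_le p (\<lambda>z. f z - f (of_real \<rho> * z)) e"
proof -
  have p0: "0 < p" using p by simp
  define M where "M = (SUP r\<in>{0..<1}. circle_mean p f r)"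
  have hf: "f holomorphic_on ball 0 1" and bdd: "bdd_above (circle_mean p f ` {0..<1})"
    using f by (auto simp: in_Hp_def)
  have cf: "continuous_on (ball 0 1) f" using hf by (rule holomorphic_on_imp_continuous_on)
  have M: "circle_mean p f r \<le> M" if "0 \<le> r" "r < 1" for r
    unfolding M_def using bdd that by (intro cSUP_upper) auto
  have M0: "0 \<le> M" using M[of 0] circle_mean_nonneg[OF hf, of 0 p] p0 by simp
  \<comment> \<open>\<open>e'\<close>, and later d, each reserve half of e for one error term; the
    summand 1 keeps the denominator positive when M = 0.\<close>
  define e' where "e' = e / (4 * M + 1)"
  have e': "0 < e'" "e' * (2 * M) \<le> e / 2"
    using e M0 by (auto simp: e'_def field_simps)
  obtain K where K: "0 \<le> K"
    "\<And>a b :: complex. norm (a - b) powr p \<le> e' * (norm a powr p + norm b powr p) + K * midpoint_gap p a b"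
    using uniform_convexity[OF p e'(1)] by blast
  define d where "d = e / (4 * (K + 1))"
  have d: "0 < d" "K * (2 * d) \<le> e / 2" using e K by (auto simp: d_def field_simps)
  obtain r0 where r0: "0 \<le> r0" "r0 < 1" "M - d < circle_mean p f r0"
    using d less_cSUP_iff[OF _ bdd, of "M - d"] by (auto simp: M_def[symmetric])
  \<comment> \<open>The p-th power of the midpoint of f and its dilate, on the single circle of
    radius \<open>r0\<close>. At \<rho> = 1 its mean is that of f, so continuity in \<rho> keeps it
    near M.\<close>
  define q where "q = (\<lambda>\<rho> t. norm ((f (of_real r0 * cis t) + f (of_real \<rho> * (of_real r0 * cis t))) / 2) powr p)"
  have "continuous_on ({0..1} \<times> UNIV) (\<lambda>(\<rho>, t). q \<rho> t)"
  proof -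
    have "\<rho> * r0 < 1" if "\<rho> \<in> {0..1}" for \<rho>
      using that r0 mult_right_mono[of \<rho> 1 r0] by auto
    then have "continuous_on ({0..1} \<times> UNIV) (\<lambda>x. f (of_real (fst x) * (of_real r0 * cis (snd x))))"
      using r0 by (intro continuous_on_compose2[OF cf] continuous_intros) (auto simp: norm_mult)
    moreover have "continuous_on ({0..1} \<times> UNIV) (\<lambda>x::real\<times>real. f (of_real r0 * cis (snd x)))"
      using r0 by (intro continuous_on_compose2[OF cf] continuous_intros) (auto simp: norm_mult)
    ultimately show ?thesis
      unfolding q_def case_prod_unfold using p0 by (intro continuous_intros) auto
  qed
  then have "continuous_on {0..1} (\<lambda>\<rho>. cmean (q \<rho>))" by (rule cmean_continuous_param)
  then have "((\<lambda>\<rho>. cmean (q \<rho>)) \<longlongrightarrow> cmean (q 1)) (at 1 within {0..1})"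
    by (simp add: continuous_on_def)
  moreover have "cmean (q 1) = circle_mean p f r0"
    by (simp add: q_def circle_mean_eq_cmean)
  moreover have "M - 2 * d < circle_mean p f r0" using r0 d by linarith
  ultimately have "\<forall>\<^sub>F \<rho> in at 1 within {0..1}. M - 2 * d < cmean (q \<rho>)"
    by (metis order_tendstoD(1))
  then have "\<forall>\<^sub>F \<rho> in at_left (1::real). M - 2 * d < cmean (q \<rho>)"
    by (simp add: at_within_Icc_at_left)
  moreover have "\<forall>\<^sub>F \<rho> in at_left (1::real). \<rho> \<in> {0<..<1}"
    by (rule eventually_at_leftI[of 0]) auto
  ultimately have "\<forall>\<^sub>F \<rho> in at_left (1::real). M - 2 * d < cmean (q \<rho>) \<and> \<rho> \<in> {0<..<1}"
    by eventually_elim auto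
  then obtain \<rho> where rho: "M - 2 * d < cmean (q \<rho>)" "0 < \<rho>" "\<rho> < 1"
    using eventually_happens[of _ "at_left (1::real)"] by auto
  define g where "g = (\<lambda>z. f (of_real \<rho> * z))"
  have hg: "g holomorphic_on ball 0 1"
    unfolding g_def using dilate_holomorphic[OF hf, of \<rho>] rho holomorphic_on_subset ball_subset_cball
    by (metis less_imp_le)
  have hm: "(\<lambda>z. (f z + g z) / 2) holomorphic_on ball 0 1"
    by (intro holomorphic_intros hf hg) auto
  have hd: "(\<lambda>z. f z - g z) holomorphic_on ball 0 1"
    by (intro holomorphic_intros hf hg)
  have gM: "circle_mean p g r \<le> M" if "0 \<le> r" "r < 1" for r
  proof -
    have "circle_mean p g r = circle_mean p f (\<rho> * r)"
      by (simp add: circle_mean_eq_cmean g_def mult.assoc)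
    moreover have "\<rho> * r < 1" using mult_left_le_one_le[of r \<rho>] that rho by linarith
    ultimately show ?thesis using M[of "\<rho> * r"] that rho by simp
  qed
  \<comment> \<open>From \<open>r0\<close> outwards, monotonicity carries the lower bound for the
    midpoint's mean along. The terms \<open>K * M\<close> cancel and leave the two reserved halves
    of e.\<close>
  have main: "circle_mean p (\<lambda>z. f z - g z) r \<le> e" if r: "r0 \<le> r" "r < 1" for r
  proof -
    have r': "0 \<le> r" using r r0 by simp
    note c1 = continuous_on_circle_powr[OF hf r' r(2) p0]
    note c2 = continuous_on_circle_powr[OF hg r' r(2) p0]
    note c3 = continuous_on_circle_powr[OF hm r' r(2) p0]
    note c4 = continuous_on_circle_powr[OF hd r' r(2) p0]
    have c5: "continuous_on UNIV (\<lambda>t. norm (f (of_real r * cis t)) powr p + norm (g (of_real r * cis t)) powr p)"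
      by (intro continuous_on_add c1 c2)
    let ?cm = "\<lambda>f. circle_mean p f r"
    have "?cm (\<lambda>z. f z - g z) \<le> cmean (\<lambda>t. (e' + K / 2) * (norm (f (of_real r * cis t)) powr p + norm (g (of_real r * cis t)) powr p)
        - K * norm ((f (of_real r * cis t) + g (of_real r * cis t)) / 2) powr p)"
      unfolding circle_mean_eq_cmean
    proof (intro cmean_mono c4 continuous_on_diff continuous_on_mult_left c5 c3)
      fix t
      show "norm (f (of_real r * cis t) - g (of_real r * cis t)) powr p
        \<le> (e' + K / 2) * (norm (f (of_real r * cis t)) powr p + norm (g (of_real r * cis t)) powr p)
        - K * norm ((f (of_real r * cis t) + g (of_real r * cis t)) / 2) powr p"
        using K(2)[of "f (of_real r * cis t)" "g (of_real r * cis t)"]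
        by (simp add: midpoint_gap_def algebra_simps add_divide_distrib)
    qed
    also have "\<dots> = (e' + K / 2) * (?cm f + ?cm g) - K * ?cm (\<lambda>z. (f z + g z) / 2)"
      unfolding circle_mean_eq_cmean cmean_add[OF c1 c2, symmetric] cmean_cmult[OF c5, symmetric]
        cmean_cmult[OF c3, symmetric]
      by (intro cmean_diff continuous_on_mult_left c5 c3)
    also have "\<dots> \<le> (e' + K / 2) * (M + M) - K * (M - 2 * d)"
    proof (intro diff_mono mult_left_mono add_mono M gM r r' K)
      have "M - 2 * d < circle_mean p (\<lambda>z. (f z + g z) / 2) r0"
        using rho by (simp add: circle_mean_eq_cmean q_def g_def)
      also have "\<dots> \<le> ?cm (\<lambda>z. (f z + g z) / 2)" using r r0 by (intro circle_mean_mono p hm)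
      finally show "M - 2 * d \<le> ?cm (\<lambda>z. (f z + g z) / 2)" by simp
    qed (use e' K in auto)
    also have "\<dots> = e' * (2 * M) + K * (2 * d)" by (simp add: algebra_simps)
    finally show ?thesis using e' d by linarith
  qed
  have "circle_mean p (\<lambda>z. f z - g z) r \<le> e" if r: "0 \<le> r" "r < 1" for r
  proof -
    have "circle_mean p (\<lambda>z. f z - g z) r \<le> circle_mean p (\<lambda>z. f z - g z) (max r r0)"
      using r r0 by (intro circle_mean_mono p hd) auto
    also have "\<dots> \<le> e" using r r0 by (intro main) auto
    finally show ?thesis .
  qed
  then have "hp_le p (\<lambda>z. f z - g z) e" using hd by (simp add: hp_le_def)
  then show thesis using that[of \<rho>] rho by (simp add: g_def)
qed

section \<open>Kernel sums from Cauchy's integral\<close>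

lemma riemann_sum_error:
  fixes g :: "real \<Rightarrow> 'a::euclidean_space"
  assumes g: "continuous_on UNIV g" and d: "0 \<le> d"
    and e: "\<And>j t. j < m \<Longrightarrow> real j * d \<le> t \<Longrightarrow> t \<le> real (Suc j) * d \<Longrightarrow> norm (g t - g (real j * d)) \<le> e"
  shows "norm (integral {0..real m * d} g - (\<Sum>j<m. d *\<^sub>R g (real j * d))) \<le> real m * d * e"
  using e
proof (induction m)
  case (Suc m)
  let ?a = "real m * d" and ?b = "real (Suc m) * d"
  have ab: "0 \<le> ?a" "?a \<le> ?b" using d by (auto intro: mult_right_mono)
  have "integral {0..?b} g = integral {0..?a} g + integral {?a..?b} g"
    using ab by (intro Henstock_Kurzweil_Integration.integral_combine[symmetric] cont_integrable g) auto
  moreover have "norm (integral {?a..?b} g - d *\<^sub>R g ?a) \<le> d * e"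
  proof -
    have "integral {?a..?b} g - d *\<^sub>R g ?a = integral {?a..?b} (\<lambda>t. g t - g ?a)"
      using ab by (subst integral_diff) (auto intro: cont_integrable g simp: algebra_simps)
    also have "norm \<dots> \<le> integral {?a..?b} (\<lambda>t. e)"
      using Suc.prems[of m] g by (intro integral_norm_bound_integral cont_integrable continuous_intros) auto
    also have "\<dots> = d * e" using ab by (simp add: algebra_simps)
    finally show ?thesis .
  qed
  moreover have "norm (integral {0..?a} g - (\<Sum>j<m. d *\<^sub>R g (real j * d))) \<le> ?a * e"
    using Suc.prems by (intro Suc.IH) auto
  ultimately have "norm ((integral {0..?a} g - (\<Sum>j<m. d *\<^sub>R g (real j * d))) + (integral {?a..?b} g - d *\<^sub>R g ?a)) \<le> ?a * e + d * e"
    by (intro norm_triangle_mono)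
  then show ?case
    using \<open>integral {0..?b} g = _\<close> by (simp add: algebra_simps)
qed simp

definition kernel_sum :: "nat \<Rightarrow> (nat \<Rightarrow> complex) \<Rightarrow> (nat \<Rightarrow> complex) \<Rightarrow> complex \<Rightarrow> complex" where
  "kernel_sum m c w z = (\<Sum>j<m. c j / (1 - cnj (w j) * z))"

lemma kernel_denominator_nz:
  assumes "norm w < 1" "norm z \<le> 1"
  shows "1 - cnj w * z \<noteq> 0"
proof
  assume "1 - cnj w * z = 0"
  then have "norm (cnj w * z) = 1" by (metis eq_iff_diff_eq_0 norm_one)
  moreover have "norm w * norm z \<le> norm w" using assms by (simp add: mult_left_le)
  ultimately show False using assms by (simp add: norm_mult)
qed

text \<open>Cauchy's formula on an intermediate circle writes the dilate as a mean of kernels with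
  nodes strictly inside the disc. The integrand is then jointly continuous for z in the closed disc,
  so Riemann sums converge uniformly in z.\<close>

lemma dilate_kernel_approx:
  assumes f: "f holomorphic_on ball 0 1" and \<rho>: "0 \<le> \<rho>" "\<rho> < 1" and e: "0 < e"
  obtains m c w where "\<And>j. norm (w j) < 1"
    "\<And>z. norm z \<le> 1 \<Longrightarrow> norm (f (of_real \<rho> * z) - kernel_sum m c w z) \<le> e"
proof -
  \<comment> \<open>Any radius strictly between \<rho> and 1 would do; it makes the radius u =
    \<rho> / \<sigma> of the nodes less than 1.\<close>
  define \<sigma> where "\<sigma> = (1 + \<rho>) / 2"
  have \<sigma>: "0 < \<sigma>" "\<sigma> < 1" "\<rho> < \<sigma>" using \<rho> by (auto simp: \<sigma>_def)
  define u where "u = \<rho> / \<sigma>"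
  have u: "0 \<le> u" "u < 1" "\<sigma> * u = \<rho>" using \<rho> \<sigma> by (auto simp: u_def)
  define F where "F = (\<lambda>z. f (of_real \<sigma> * z))"
  have F: "F holomorphic_on cball 0 1" unfolding F_def using \<sigma> by (intro dilate_holomorphic f) auto
  have cF: "continuous_on (cball 0 1) F" using F by (rule holomorphic_on_imp_continuous_on)
  have cFc: "continuous_on A (\<lambda>x. F (cis (k x)))" if "continuous_on A k" for A and k :: "'b::topological_space \<Rightarrow> real"
    by (rule continuous_on_compose2[OF cF]) (auto intro!: continuous_intros that)
  define w where "w = (\<lambda>t. complex_of_real u * cis t)"
  have nw: "norm (w t) < 1" for t using u by (simp add: w_def norm_mult)
  define G where "G = (\<lambda>z t. F (cis t) / (1 - cnj (w t) * z))"
  have nz: "1 - cnj (w t) * z \<noteq> 0" if "norm z \<le> 1" for z t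
    using kernel_denominator_nz[OF nw that] .
  have cG: "continuous_on UNIV (G z)" if "norm z \<le> 1" for z
    unfolding G_def using nz[OF that] by (intro continuous_intros cFc) (auto simp: w_def intro!: continuous_intros)
  have rep: "f (of_real \<rho> * z) = cmean (G z)" if z: "norm z \<le> 1" for z
  proof -
    have "f (of_real \<rho> * z) = F (of_real u * z)"
      unfolding F_def u(3)[symmetric] by (simp add: mult.assoc)
    also have "\<dots> = cmean (\<lambda>t. F (cis t) * cis t / (cis t - of_real u * z))"
    proof (rule Cauchy_circle_mean[symmetric, OF cF])
      show "F holomorphic_on ball 0 1" using F holomorphic_on_subset ball_subset_cball by blast
      have "u * norm z \<le> u" using u z by (simp add: mult_left_le)
      then show "norm (of_real u * z) < 1" using u by (simp add: norm_mult)
    qed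
    also have "\<dots> = cmean (G z)"
    proof -
      have "F (cis t) * cis t / (cis t - of_real u * z) = G z t" for t
      proof -
        have "1 - cnj (w t) * z = (cis t - of_real u * z) / cis t"
          unfolding w_def by (simp add: cnj_cis_eq diff_divide_distrib)
        then show ?thesis unfolding G_def by simp
      qed
      then show ?thesis by simp
    qed
    finally show ?thesis .
  qed
  have "continuous_on (cball 0 1 \<times> {0..2*pi}) (\<lambda>x. G (fst x) (snd x))"
    unfolding G_def using nz by (intro continuous_intros cFc) (auto simp: w_def intro!: continuous_intros)
  moreover have "compact (cball (0::complex) 1 \<times> {0..2*pi})" by (intro compact_Times compact_cball compact_Icc)
  ultimately have "uniformly_continuous_on (cball 0 1 \<times> {0..2*pi}) (\<lambda>x. G (fst x) (snd x))"
    by (rule compact_uniformly_continuous)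
  then obtain \<delta> where \<delta>: "0 < \<delta>"
    "\<And>x y. x \<in> cball 0 1 \<times> {0..2*pi} \<Longrightarrow> y \<in> cball 0 1 \<times> {0..2*pi} \<Longrightarrow> dist y x < \<delta> \<Longrightarrow>
       dist (G (fst y) (snd y)) (G (fst x) (snd x)) < e"
    using e unfolding uniformly_continuous_on_def by metis
  \<comment> \<open>Uniform continuity jointly in z and t gives one mesh for all z.\<close>
  obtain m where m: "2 * pi / \<delta> < real m" using reals_Archimedean2 by blast
  have "0 < 2 * pi / \<delta>" using \<delta> by simp
  then have m0: "0 < m" using m by (metis less_trans of_nat_0_less_iff)
  define d where "d = 2 * pi / real m"
  have d: "0 < d" "d < \<delta>" "real m * d = 2 * pi"
    using m m0 \<delta> by (auto simp: d_def field_simps)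
  define c where "c = (\<lambda>j. F (cis (real j * d)) / of_nat m)"
  have "norm (f (of_real \<rho> * z) - kernel_sum m c (\<lambda>j. w (real j * d)) z) \<le> e" if z: "norm z \<le> 1" for z
  proof -
    have "norm (integral {0..real m * d} (G z) - (\<Sum>j<m. d *\<^sub>R G z (real j * d))) \<le> real m * d * e"
    proof (rule riemann_sum_error[OF cG[OF z]])
      fix j t assume j: "j < m" "real j * d \<le> t" "t \<le> real (Suc j) * d"
      have "real (Suc j) * d \<le> real m * d" using j d by (intro mult_right_mono) auto
      then have tm: "t \<le> 2 * pi" "real j * d \<le> 2 * pi" using j d by auto
      have j0: "0 \<le> real j * d" using d by simp
      have "dist t (real j * d) < \<delta>" using j d by (simp add: dist_real_def algebra_simps)
      then have "dist (G z t) (G z (real j * d)) < e"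
        using \<delta>(2)[of "(z, real j * d)" "(z, t)"] z tm j0 j by (simp add: dist_Pair_Pair)
      then show "norm (G z t - G z (real j * d)) \<le> e" by (simp add: dist_norm)
    qed (use d in auto)
    then have "norm (integral {0..2*pi} (G z) - (\<Sum>j<m. d *\<^sub>R G z (real j * d))) \<le> 2 * pi * e"
      by (simp only: d)
    then have "norm ((1 / (2*pi)) *\<^sub>R (integral {0..2*pi} (G z) - (\<Sum>j<m. d *\<^sub>R G z (real j * d)))) \<le> (1 / (2*pi)) * (2 * pi * e)"
      unfolding norm_scaleR by (intro mult_mono) auto
    moreover have "(1 / (2*pi)) *\<^sub>R (integral {0..2*pi} (G z) - (\<Sum>j<m. d *\<^sub>R G z (real j * d)))
        = f (of_real \<rho> * z) - kernel_sum m c (\<lambda>j. w (real j * d)) z"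
    proof -
      have "(1 / (2*pi)) *\<^sub>R (\<Sum>j<m. d *\<^sub>R G z (real j * d)) = kernel_sum m c (\<lambda>j. w (real j * d)) z"
        unfolding kernel_sum_def scaleR_sum_right
        by (intro sum.cong) (auto simp: G_def c_def d_def scaleR_conv_of_real)
      then show ?thesis unfolding rep[OF z] cmean_def scaleR_diff_right by simp
    qed
    ultimately show ?thesis by simp
  qed
  then show thesis using that[of "\<lambda>j. w (real j * d)" m c] nw by blast
qed

text \<open>A uniform bound on the disc becomes a bound on p-th means. The choice of
  \<open>e'\<close> lets the two errors add up to e after the factor
  \<open>2 powr p\<close>.\<close>

lemma kernel_sum_dense:
  assumes p: "1 < p" and f: "in_Hp p f" and e: "0 < e"
  obtains m c w where "\<And>j. norm (w j) < 1" "hp_le p (\<lambda>z. f z - kernel_sum m c w z) e"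
proof -
  have p0: "0 < p" using p by simp
  define e' where "e' = e / (2 * 2 powr p)"
  have e': "0 < e'" "2 powr p * (e' + e') = e" using e by (auto simp: e'_def)
  obtain \<rho> where \<rho>: "0 \<le> \<rho>" "\<rho> < 1" and d: "hp_le p (\<lambda>z. f z - f (of_real \<rho> * z)) e'"
    using dilate_tendsto[OF p f e'(1)] by blast
  have hf: "f holomorphic_on ball 0 1" using f by (simp add: in_Hp_def)
  have "0 < e' powr (1 / p)" using e' by simp
  then obtain m c w where w: "\<And>j. norm (w j) < 1"
    and k: "\<And>z. norm z \<le> 1 \<Longrightarrow> norm (f (of_real \<rho> * z) - kernel_sum m c w z) \<le> e' powr (1 / p)"
    using dilate_kernel_approx[OF hf \<rho>] by metis
  have nz: "1 - cnj (w j) * z \<noteq> 0" if "norm z < 1" for j z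
    using kernel_denominator_nz[OF w] that by auto
  have "(\<lambda>z. f (of_real \<rho> * z) - kernel_sum m c w z) holomorphic_on ball 0 1"
    unfolding kernel_sum_def using nz \<rho>
    by (intro holomorphic_intros holomorphic_on_subset[OF dilate_holomorphic[OF hf]]) auto
  then have "hp_le p (\<lambda>z. f (of_real \<rho> * z) - kernel_sum m c w z) ((e' powr (1 / p)) powr p)"
    using k p0 by (intro hp_le_bounded) auto
  then have "hp_le p (\<lambda>z. f (of_real \<rho> * z) - kernel_sum m c w z) e'"
    using e' p0 by (simp add: powr_powr)
  from hp_le_add[OF d this p0] have "hp_le p (\<lambda>z. f z - kernel_sum m c w z) e"
    unfolding e'(2) by simp
  with w that show thesis by blast
qed

section \<open>Co-analytic Toeplitz operators\<close>

text \<open>Convergence is obtained without a candidate limit: the approximants of accuracy 1 / (n +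
  1) are uniformly Cauchy, each pair being compared through a common \<open>\<phi> s\<close>, and
  their limit is also that of \<phi>.\<close>

lemma uniform_limit_of_approximations:
  fixes \<phi> :: "'a \<Rightarrow> 'b \<Rightarrow> 'c::complete_space"
  assumes F: "F \<noteq> bot"
    and appr: "\<And>e. 0 < e \<Longrightarrow> \<exists>g. \<forall>\<^sub>F s in F. \<forall>z\<in>K. dist (\<phi> s z) (g z) < e"
  shows "uniform_limit K \<phi> (\<lambda>z. Lim F (\<lambda>s. \<phi> s z)) F"
proof -
  have "\<forall>n::nat. \<exists>g. \<forall>\<^sub>F s in F. \<forall>z\<in>K. dist (\<phi> s z) (g z) < 1 / real (Suc n)"
    by (intro allI appr) simp
  then obtain g where g: "\<And>n::nat. \<forall>\<^sub>F s in F. \<forall>z\<in>K. dist (\<phi> s z) (g n z) < 1 / real (Suc n)"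
    by (auto dest!: choice)
  have gg: "dist (g n z) (g m z) < 1 / real (Suc n) + 1 / real (Suc m)" if "z \<in> K" for n m z
  proof -
    have "\<forall>\<^sub>F s in F. dist (g n z) (g m z) < 1 / real (Suc n) + 1 / real (Suc m)"
      using g[of n] g[of m]
    proof eventually_elim
      case (elim s)
      have "dist (\<phi> s z) (g n z) < 1 / real (Suc n)" "dist (\<phi> s z) (g m z) < 1 / real (Suc m)"
        using elim that by auto
      then show ?case using dist_triangle3[of "g n z" "g m z" "\<phi> s z"] by linarith
    qed
    then show ?thesis using F by simp
  qed
  have half: "\<exists>N. \<forall>n\<ge>N. 1 / real (Suc n) < e / 2" if "0 < e" for e
  proof -
    have "0 < e / 2" using that by simp
    from reals_Archimedean[OF this] obtain N where N: "1 / real (Suc N) < e / 2"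
      unfolding inverse_eq_divide by blast
    have "1 / real (Suc n) < e / 2" if "N \<le> n" for n
    proof -
      have "1 / real (Suc n) \<le> 1 / real (Suc N)" using that by (intro divide_left_mono) auto
      then show ?thesis using N by linarith
    qed
    then show ?thesis by blast
  qed
  have "uniformly_Cauchy_on K g"
    unfolding uniformly_Cauchy_on_def
  proof (intro allI impI)
    fix e :: real assume "0 < e"
    then obtain N where N: "\<And>n. N \<le> n \<Longrightarrow> 1 / real (Suc n) < e / 2" using half by blast
    have "dist (g m z) (g n z) < e" if "z \<in> K" "N \<le> m" "N \<le> n" for z m n
      using gg[OF that(1), of m n] N[OF that(2)] N[OF that(3)] by linarith
    then show "\<exists>M. \<forall>x\<in>K. \<forall>m\<ge>M. \<forall>n\<ge>M. dist (g m x) (g n x) < e" by blast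
  qed
  then have "uniformly_convergent_on K g" by (simp add: uniformly_convergent_eq_Cauchy)
  then obtain l where l: "uniform_limit K g l sequentially"
    by (auto simp: uniformly_convergent_on_def)
  have lim: "uniform_limit K \<phi> l F"
    unfolding uniform_limit_iff
  proof (intro allI impI)
    fix e :: real assume e: "0 < e"
    then obtain N where N: "\<And>n. N \<le> n \<Longrightarrow> 1 / real (Suc n) < e / 2" using half by blast
    obtain n where n: "N \<le> n" "\<And>z. z \<in> K \<Longrightarrow> dist (g n z) (l z) < e / 2"
      using l e unfolding uniform_limit_sequentially_iff by (metis half_gt_zero max.cobounded1 max.cobounded2)
    show "\<forall>\<^sub>F s in F. \<forall>z\<in>K. dist (\<phi> s z) (l z) < e"
      using g[of n]
    proof eventually_elim
      case (elim s)
      show ?case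
      proof
        fix z assume "z \<in> K"
        then have "dist (\<phi> s z) (g n z) < e / 2" "dist (g n z) (l z) < e / 2"
          using elim n N[of n] by fastforce+
        then show "dist (\<phi> s z) (l z) < e" using dist_triangle[of "\<phi> s z" "l z" "g n z"] by linarith
      qed
    qed
  qed
  then have "Lim F (\<lambda>s. \<phi> s z) = l z" if "z \<in> K" for z
    using F that by (intro tendsto_Lim tendsto_uniform_limitI)
  then show ?thesis
    using uniform_limit_cong'[of K "\<phi>" "\<phi>" l "\<lambda>z. Lim F (\<lambda>s. \<phi> s z)" F] lim by simp
qed

text \<open>Uniform continuity on the compact product, which contains the endpoint s = 1.\<close>

lemma uniform_limit_at_left_1:
  fixes h :: "real \<Rightarrow> 'a::metric_space \<Rightarrow> 'b::metric_space"
  assumes "compact K" "continuous_on ({0..1} \<times> K) (\<lambda>(s, z). h s z)"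
  shows "uniform_limit K h (h 1) (at_left 1)"
  unfolding uniform_limit_iff
proof (intro allI impI)
  fix e :: real assume "0 < e"
  have "uniformly_continuous_on ({0..1} \<times> K) (\<lambda>(s, z). h s z)"
    using assms by (intro compact_uniformly_continuous compact_Times compact_Icc)
  then obtain d where d: "0 < d" "\<And>x y. x \<in> {0..1} \<times> K \<Longrightarrow> y \<in> {0..1} \<times> K \<Longrightarrow> dist y x < d \<Longrightarrow>
      dist (h (fst y) (snd y)) (h (fst x) (snd x)) < e"
    using \<open>0 < e\<close> unfolding uniformly_continuous_on_def case_prod_unfold by metis
  have "\<forall>z\<in>K. dist (h s z) (h 1 z) < e" if "max 0 (1 - d) < s" "s < 1" for s
    using d(2)[of "(1, _)" "(s, _)"] that by (auto simp: dist_Pair_Pair dist_real_def)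
  then show "\<forall>\<^sub>F s in at_left 1. \<forall>z\<in>K. dist (h s z) (h 1 z) < e"
    using d(1) by (intro eventually_at_leftI[of "max 0 (1 - d)"]) auto
qed

section \<open>Toeplitz integrals at radius below 1 and their limit\<close>

definition toeplitz_mean :: "(complex \<Rightarrow> complex) \<Rightarrow> (complex \<Rightarrow> complex) \<Rightarrow> real \<Rightarrow> complex \<Rightarrow> complex" where
  "toeplitz_mean B f s = szego (\<lambda>t. cnj (B (of_real s * cis t)) * f (of_real s * cis t))"

lemma toeplitz_conj_eq: "toeplitz_conj B f z = Lim (at_left 1) (\<lambda>s. toeplitz_mean B f s z)"
  by (simp add: toeplitz_conj_def toeplitz_mean_def szego_def cmean_def scaleR_conv_of_real)

lemma in_Hinf_ball_holomorphic: "in_Hinf_ball B \<Longrightarrow> B holomorphic_on ball 0 1"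
  by (simp add: in_Hinf_ball_def)

lemma in_Hinf_ball_norm: "in_Hinf_ball B \<Longrightarrow> norm z < 1 \<Longrightarrow> norm (B z) \<le> 1"
  by (simp add: in_Hinf_ball_def)

lemma continuous_on_toeplitz_integrand:
  assumes "in_Hinf_ball B" "f holomorphic_on ball 0 1" "0 \<le> s" "s < 1"
  shows "continuous_on UNIV (\<lambda>t. cnj (B (of_real s * cis t)) * f (of_real s * cis t))"
  using continuous_on_holomorphic_circle[OF in_Hinf_ball_holomorphic[OF assms(1)] assms(3,4)]
    continuous_on_holomorphic_circle[OF assms(2-4)]
  by (intro continuous_intros)

lemma toeplitz_mean_holomorphic:
  assumes "in_Hinf_ball B" "f holomorphic_on ball 0 1" "0 \<le> s" "s < 1"
  shows "toeplitz_mean B f s holomorphic_on ball 0 1"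
  unfolding toeplitz_mean_def by (intro szego_holomorphic continuous_on_toeplitz_integrand assms)

lemma toeplitz_mean_diff:
  assumes "in_Hinf_ball B" "f holomorphic_on ball 0 1" "g holomorphic_on ball 0 1" "0 \<le> s" "s < 1" "norm z < 1"
  shows "toeplitz_mean B (\<lambda>z. f z - g z) s z = toeplitz_mean B f s z - toeplitz_mean B g s z"
  unfolding toeplitz_mean_def right_diff_distrib
  by (intro szego_diff continuous_on_toeplitz_integrand assms)

text \<open>The supremum of the kernel times an L^1 mean, which Jensen's inequality bounds by the
  p-th mean. Crude near the circle, but uniform in s and independent of Riesz's theorem.\<close>

lemma norm_toeplitz_mean_le:
  assumes B: "in_Hinf_ball B" and f: "hp_le p f M" and p: "1 < p" and s: "0 \<le> s" "s < 1" and z: "norm z < 1"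
  shows "norm (toeplitz_mean B f s z) \<le> M powr (1 / p) / (1 - norm z)"
proof -
  define h where "h = (\<lambda>t. cnj (B (of_real s * cis t)) * f (of_real s * cis t))"
  have hf: "f holomorphic_on ball 0 1" using f by (simp add: hp_le_def)
  have h: "continuous_on UNIV h" unfolding h_def by (intro continuous_on_toeplitz_integrand B hf s)
  have cf: "continuous_on UNIV (\<lambda>t. f (of_real s * cis t))"
    by (intro continuous_on_holomorphic_circle hf s)
  define m where "m = cmean (\<lambda>t. norm (f (of_real s * cis t)))"
  have m: "0 \<le> m" unfolding m_def by (intro cmean_nonneg continuous_intros cf) auto
  have "m powr p \<le> cmean (\<lambda>t. norm (f (of_real s * cis t)) powr p)"
    unfolding m_def using p by (intro cmean_powr_le continuous_intros cf) auto
  also have "\<dots> \<le> M" using f s by (simp add: hp_le_def circle_mean_eq_cmean)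
  finally have "(m powr p) powr (1 / p) \<le> M powr (1 / p)" using p by (intro powr_mono2) auto
  then have mM: "m \<le> M powr (1 / p)" using m p by (simp add: powr_powr)
  have "norm (szego h z) \<le> cmean (\<lambda>t. norm (h t / (1 - z * cnj (cis t))))"
    unfolding szego_def by (intro norm_cmean_le continuous_on_szego_integrand h z)
  also have "\<dots> \<le> cmean (\<lambda>t. norm (f (of_real s * cis t)) * (1 / (1 - norm z)))"
  proof (intro cmean_mono continuous_on_norm continuous_on_szego_integrand continuous_on_mult_right h z cf)
    fix t
    have "norm (h t) \<le> norm (f (of_real s * cis t))"
      using in_Hinf_ball_norm[OF B, of "of_real s * cis t"] s
        mult_right_mono[of "norm (B (of_real s * cis t))" 1 "norm (f (of_real s * cis t))"]
      by (simp add: h_def norm_mult)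
    then have "norm (h t) / norm (1 - z * cnj (cis t)) \<le> norm (f (of_real s * cis t)) / (1 - norm z)"
      using szego_denominator[of z t] z by (intro frac_le) auto
    then show "norm (h t / (1 - z * cnj (cis t))) \<le> norm (f (of_real s * cis t)) * (1 / (1 - norm z))"
      by (simp add: norm_divide)
  qed
  also have "\<dots> = m * (1 / (1 - norm z))"
    unfolding m_def by (intro cmean_cmult_right continuous_intros cf)
  also have "\<dots> \<le> M powr (1 / p) * (1 / (1 - norm z))"
    using mM z by (intro mult_right_mono) auto
  finally show ?thesis by (simp add: toeplitz_mean_def h_def)
qed

lemma kernel_denominator_ge:
  assumes "norm w < 1" "norm z \<le> 1"
  shows "1 - norm w \<le> norm (1 - cnj w * z)"
proof -
  have "norm w * norm z \<le> norm w" using assms by (simp add: mult_left_le)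
  then show ?thesis using norm_triangle_ineq2[of 1 "cnj w * z"] by (simp add: norm_mult)
qed

lemma kernel_sum_holomorphic:
  assumes "\<And>j. norm (w j) < 1"
  shows "kernel_sum m c w holomorphic_on ball 0 1"
  unfolding kernel_sum_def using kernel_denominator_nz[OF assms]
  by (intro holomorphic_intros) auto

lemma norm_kernel_sum_le:
  assumes "\<And>j. norm (w j) < 1" "norm z < 1"
  shows "norm (kernel_sum m c w z) \<le> (\<Sum>j<m. norm (c j) / (1 - norm (w j)))"
  unfolding kernel_sum_def
proof (rule sum_norm_le)
  fix j
  show "norm (c j / (1 - cnj (w j) * z)) \<le> norm (c j) / (1 - norm (w j))"
    unfolding norm_divide using kernel_denominator_ge[OF assms(1), of z j] assms less_imp_le[OF assms(2)]
    by (intro frac_le) auto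
qed

lemma hp_le_kernel_sum:
  assumes "\<And>j. norm (w j) < 1" "0 < p"
  shows "hp_le p (kernel_sum m c w) ((\<Sum>j<m. norm (c j) / (1 - norm (w j))) powr p)"
  by (intro hp_le_bounded kernel_sum_holomorphic norm_kernel_sum_le assms)

text \<open>After conjugation the integral is Cauchy's formula for \<open>\<zeta> \<mapsto> B (s \<zeta>) / (1 - s (cnj z) \<zeta>)\<close>
  at the point \<open>s w\<close>; hence kernels are eigenvectors of every co-analytic Toeplitz operator.\<close>

lemma toeplitz_mean_kernel:
  assumes B: "in_Hinf_ball B" and w: "norm w < 1" and z: "norm z < 1" and s: "0 \<le> s" "s < 1"
  shows "toeplitz_mean B (\<lambda>z. 1 / (1 - cnj w * z)) s z
       = cnj (B (of_real s * (of_real s * w))) / (1 - of_real s * cnj w * z)"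
proof -
  define G where "G = (\<lambda>u. B (of_real s * u) / (1 - cnj z * u))"
  have nz: "1 - cnj z * u \<noteq> 0" if "norm u \<le> 1" for u using kernel_denominator_nz[OF z that] .
  have G: "G holomorphic_on cball 0 1"
    unfolding G_def using nz
    by (intro holomorphic_intros dilate_holomorphic in_Hinf_ball_holomorphic B s) auto
  have sw: "norm (of_real s * w) < 1"
    using mult_left_le_one_le[of "norm w" s] s w by (simp add: norm_mult)
  define k where "k = (\<lambda>t. cnj (B (of_real s * cis t)) * (1 / (1 - cnj w * (of_real s * cis t))) / (1 - z * cnj (cis t)))"
  have nz2: "1 - cnj w * (of_real s * cis t) \<noteq> 0" for t
    using s by (intro kernel_denominator_nz w) (auto simp: norm_mult)
  have hk: "(\<lambda>z. 1 / (1 - cnj w * z)) holomorphic_on ball 0 1"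
    using kernel_denominator_nz[OF w] by (intro holomorphic_intros) auto
  have ck: "continuous_on UNIV k"
    unfolding k_def using continuous_on_toeplitz_integrand[OF B hk s] z
    by (intro continuous_on_szego_integrand) auto
  have "cnj (k t) = G (cis t) * cis t / (cis t - of_real s * w)" for t
  proof -
    have "1 - w * (of_real s * cnj (cis t)) = (cis t - of_real s * w) / cis t"
      by (simp add: cnj_cis_eq diff_divide_distrib mult_ac)
    then show ?thesis by (simp add: k_def G_def)
  qed
  then have "cnj (cmean k) = cmean (\<lambda>t. G (cis t) * cis t / (cis t - of_real s * w))"
    using cmean_linear[OF bounded_linear_cnj ck] by simp
  also have "\<dots> = G (of_real s * w)"
    using G holomorphic_on_subset[OF G ball_subset_cball] sw
    by (intro Cauchy_circle_mean holomorphic_on_imp_continuous_on)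
  finally have "cmean k = cnj (G (of_real s * w))" by (metis complex_cnj_cnj)
  then show ?thesis
    by (simp add: toeplitz_mean_def szego_def k_def G_def mult_ac)
qed

lemma toeplitz_mean_kernel_sum:
  assumes B: "in_Hinf_ball B" and w: "\<And>j. norm (w j) < 1" and z: "norm z < 1" and s: "0 \<le> s" "s < 1"
  shows "toeplitz_mean B (kernel_sum m c w) s z
       = (\<Sum>j<m. c j * (cnj (B (of_real s * (of_real s * w j))) / (1 - of_real s * cnj (w j) * z)))"
proof -
  let ?h = "\<lambda>j t. cnj (B (of_real s * cis t)) * (1 / (1 - cnj (w j) * (of_real s * cis t)))"
  have hk: "(\<lambda>z. 1 / (1 - cnj (w j) * z)) holomorphic_on ball 0 1" for j
    using kernel_denominator_nz[OF w] by (intro holomorphic_intros) auto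
  have c: "continuous_on UNIV (\<lambda>t. ?h j t / (1 - z * cnj (cis t)))" for j
    by (intro continuous_on_szego_integrand continuous_on_toeplitz_integrand[OF B hk s] z)
  have "toeplitz_mean B (kernel_sum m c w) s z = cmean (\<lambda>t. \<Sum>j<m. c j * (?h j t / (1 - z * cnj (cis t))))"
    unfolding toeplitz_mean_def szego_def kernel_sum_def sum_distrib_left sum_divide_distrib
    by (simp add: mult.commute)
  also have "\<dots> = (\<Sum>j<m. cmean (\<lambda>t. c j * (?h j t / (1 - z * cnj (cis t)))))"
    by (intro cmean_sum continuous_on_mult_left c) auto
  also have "\<dots> = (\<Sum>j<m. c j * toeplitz_mean B (\<lambda>z. 1 / (1 - cnj (w j) * z)) s z)"
    unfolding toeplitz_mean_def szego_def by (intro sum.cong refl cmean_cmult c)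
  also have "\<dots> = (\<Sum>j<m. c j * (cnj (B (of_real s * (of_real s * w j))) / (1 - of_real s * cnj (w j) * z)))"
    by (simp only: toeplitz_mean_kernel[OF B w z s])
  finally show ?thesis .
qed

text \<open>For z in a smaller disc the closed form is continuous up to s = 1, where it exhibits the
  eigenvalues \<open>cnj (B (w j))\<close>.\<close>

lemma toeplitz_mean_kernel_sum_limit:
  assumes B: "in_Hinf_ball B" and w: "\<And>j. norm (w j) < 1" and R: "R < 1"
  shows "uniform_limit (cball 0 R) (toeplitz_mean B (kernel_sum m c w))
           (kernel_sum m (\<lambda>j. c j * cnj (B (w j))) w) (at_left 1)"
proof -
  define h where "h = (\<lambda>s z. \<Sum>j<m. c j * (cnj (B (of_real s * (of_real s * w j))) / (1 - of_real s * cnj (w j) * z)))"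
  have cB: "continuous_on (ball 0 1) B"
    using B by (intro holomorphic_on_imp_continuous_on in_Hinf_ball_holomorphic)
  have "uniform_limit (cball 0 R) h (h 1) (at_left 1)"
  proof (rule uniform_limit_at_left_1)
    have nz: "1 - of_real s * cnj (w j) * z \<noteq> 0" if "s \<in> {0..1}" "z \<in> cball 0 R" for s z j
    proof -
      have "norm (of_real s * z) \<le> 1"
        using mult_left_le_one_le[of "norm z" s] that R by (simp add: norm_mult)
      from kernel_denominator_nz[OF w this, of j] show ?thesis
        by (simp add: mult.assoc mult.left_commute[of "cnj (w j)"])
    qed
    have "norm (of_real s * (of_real s * w j)) < 1" if "s \<in> {0..1}" for s j
      using mult_left_le_one_le[of "norm (w j)" "s * s"] that w[of j] mult_le_one[of s s]
      by (simp add: norm_mult mult.assoc)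
    then have cc: "continuous_on ({0..1} \<times> cball 0 R) (\<lambda>x::real\<times>complex. B (of_real (fst x) * (of_real (fst x) * w j)))" for j
      by (intro continuous_on_compose2[OF cB] continuous_intros) auto
    show "continuous_on ({0..1} \<times> cball 0 R) (\<lambda>(s, z). h s z)"
      unfolding h_def case_prod_unfold using nz
      by (intro continuous_intros cc) auto
  qed auto
  moreover have h1: "h 1 = kernel_sum m (\<lambda>j. c j * cnj (B (w j))) w"
    by (simp add: h_def kernel_sum_def fun_eq_iff)
  moreover have ev: "\<forall>\<^sub>F s in at_left 1. \<forall>z\<in>cball 0 R. h s z = toeplitz_mean B (kernel_sum m c w) s z"
  proof (rule eventually_at_leftI[of 0])
    fix s :: real assume "s \<in> {0<..<1}"
    then show "\<forall>z\<in>cball 0 R. h s z = toeplitz_mean B (kernel_sum m c w) s z"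
      unfolding h_def using R by (intro ballI toeplitz_mean_kernel_sum[symmetric] B w) auto
  qed auto
  ultimately show ?thesis
    using uniform_limit_cong[OF ev refl, of "h 1"] by simp
qed

text \<open>Guarantees that the \<open>Lim\<close> in \<open>toeplitz_conj\<close> is a genuine
  limit. Kernel sums supply the approximants; the pointwise bound makes the error small uniformly in
  s and z.\<close>

lemma toeplitz_uniform_limit:
  assumes B: "in_Hinf_ball B" and f: "in_Hp p f" and p: "1 < p" and R: "R < 1"
  shows "uniform_limit (cball 0 R) (toeplitz_mean B f) (toeplitz_conj B f) (at_left 1)"
proof -
  have "\<exists>g. \<forall>\<^sub>F s in at_left 1. \<forall>z\<in>cball 0 R. dist (toeplitz_mean B f s z) (g z) < e" if e: "0 < e" for e
  proof -
    \<comment> \<open>On \<open>cball 0 R\<close> the kernel costs at most 1 / (1 - R), so a norm of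
      size x gives an error of e / 2; d is the p-th power of x.\<close>
    define x where "x = e / 2 * (1 - R)"
    have x: "0 < x" using e R by (simp add: x_def)
    define d where "d = x powr p"
    have d: "0 < d" "d powr (1 / p) = x"
      using x p by (simp_all add: d_def powr_powr)
    obtain m c w where w: "\<And>j. norm (w j) < 1" and k: "hp_le p (\<lambda>z. f z - kernel_sum m c w z) d"
      by (rule kernel_sum_dense[OF p f d(1)]) (rule that)
    have hf: "f holomorphic_on ball 0 1" using f by (simp add: in_Hp_def)
    have hk: "kernel_sum m c w holomorphic_on ball 0 1" by (rule kernel_sum_holomorphic[OF w])
    define g where "g = kernel_sum m (\<lambda>j. c j * cnj (B (w j))) w"
    have "\<forall>\<^sub>F s in at_left 1. \<forall>z\<in>cball 0 R. dist (toeplitz_mean B (kernel_sum m c w) s z) (g z) < e / 2"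
      unfolding g_def using e by (intro uniform_limitD toeplitz_mean_kernel_sum_limit B w R) simp
    moreover have "\<forall>\<^sub>F s in at_left (1::real). s \<in> {0<..<1}"
      by (rule eventually_at_leftI[of 0]) auto
    ultimately have "\<forall>\<^sub>F s in at_left 1. \<forall>z\<in>cball 0 R. dist (toeplitz_mean B f s z) (g z) < e"
    proof eventually_elim
      case (elim s)
      then have s: "0 \<le> s" "s < 1" by auto
      show ?case
      proof
        fix z :: complex assume zR: "z \<in> cball 0 R"
        then have z: "norm z < 1" using R by auto
        have "norm (toeplitz_mean B f s z - toeplitz_mean B (kernel_sum m c w) s z)
            = norm (toeplitz_mean B (\<lambda>z. f z - kernel_sum m c w z) s z)"
          by (simp add: toeplitz_mean_diff[OF B hf hk s z])
        also have "\<dots> \<le> d powr (1 / p) / (1 - norm z)"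
          by (rule norm_toeplitz_mean_le[OF B k p s z])
        also have "\<dots> \<le> e / 2"
        proof -
          have "e / 2 * (1 - R) \<le> e / 2 * (1 - norm z)" using zR e by (intro mult_left_mono) auto
          then show ?thesis using z unfolding d(2) x_def by (simp only: pos_divide_le_eq diff_gt_0_iff_gt)
        qed
        finally have "dist (toeplitz_mean B f s z) (toeplitz_mean B (kernel_sum m c w) s z) \<le> e / 2"
          by (simp add: dist_norm)
        moreover have "dist (toeplitz_mean B (kernel_sum m c w) s z) (g z) < e / 2" using elim zR by auto
        ultimately show "dist (toeplitz_mean B f s z) (g z) < e"
          using dist_triangle[of "toeplitz_mean B f s z" "g z" "toeplitz_mean B (kernel_sum m c w) s z"] by linarith
      qed
    qed
    then show ?thesis by blast
  qed
  then have "uniform_limit (cball 0 R) (toeplitz_mean B f) (\<lambda>z. Lim (at_left 1) (\<lambda>s. toeplitz_mean B f s z)) (at_left 1)"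
    by (intro uniform_limit_of_approximations) auto
  then show ?thesis by (simp add: toeplitz_conj_eq[abs_def])
qed

lemma toeplitz_tendsto:
  assumes "in_Hinf_ball B" "in_Hp p f" "1 < p" "norm z < 1"
  shows "((\<lambda>s. toeplitz_mean B f s z) \<longlongrightarrow> toeplitz_conj B f z) (at_left 1)"
  using tendsto_uniform_limitI[OF toeplitz_uniform_limit[OF assms]] by auto

lemma eventually_at_left_unit: "\<forall>\<^sub>F s in at_left (1::real). 0 \<le> s \<and> s < 1"
  by (rule eventually_at_leftI[of 0]) auto

text \<open>The limit is uniform on each smaller disc, hence holomorphic there, and these discs
  exhaust the unit disc.\<close>

lemma toeplitz_holomorphic:
  assumes B: "in_Hinf_ball B" and f: "in_Hp p f" and p: "1 < p"
  shows "toeplitz_conj B f holomorphic_on ball 0 1"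
proof -
  have hf: "f holomorphic_on ball 0 1" using f by (simp add: in_Hp_def)
  have "toeplitz_conj B f holomorphic_on ball 0 R" if R: "R < 1" for R
  proof (rule holomorphic_uniform_limit[OF _ toeplitz_uniform_limit[OF B f p R]])
    show "\<forall>\<^sub>F s in at_left 1. continuous_on (cball 0 R) (toeplitz_mean B f s) \<and> toeplitz_mean B f s holomorphic_on ball 0 R"
      using eventually_at_left_unit
    proof eventually_elim
      case (elim s)
      then have "toeplitz_mean B f s holomorphic_on cball 0 R"
        using R by (intro holomorphic_on_subset[OF toeplitz_mean_holomorphic[OF B hf]]) auto
      then show ?case
        using holomorphic_on_imp_continuous_on holomorphic_on_subset ball_subset_cball by blast
    qed
  qed auto
  then have "toeplitz_conj B f holomorphic_on (\<Union>R\<in>{..<1}. ball 0 R)"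
    by (intro holomorphic_on_UN_open) auto
  moreover have "(\<Union>R\<in>{..<1}. ball (0::complex) R) = ball 0 1"
  proof (intro equalityI subsetI)
    fix z :: complex assume "z \<in> ball 0 1"
    then have "z \<in> ball 0 ((norm z + 1) / 2)" "(norm z + 1) / 2 < 1" by auto
    then show "z \<in> (\<Union>R\<in>{..<1}. ball 0 R)" by blast
  qed auto
  ultimately show ?thesis by simp
qed

lemma in_Hp_diff:
  assumes "in_Hp p f" "in_Hp p g" "0 < p"
  shows "in_Hp p (\<lambda>z. f z - g z)"
  using assms hp_le_diff unfolding in_Hp_iff_hp_le by blast

lemma toeplitz_diff:
  assumes B: "in_Hinf_ball B" and f: "in_Hp p f" and g: "in_Hp p g" and p: "1 < p" and z: "norm z < 1"
  shows "toeplitz_conj B (\<lambda>z. f z - g z) z = toeplitz_conj B f z - toeplitz_conj B g z"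
proof -
  have h: "f holomorphic_on ball 0 1" "g holomorphic_on ball 0 1" using f g by (auto simp: in_Hp_def)
  have "((\<lambda>s. toeplitz_mean B f s z - toeplitz_mean B g s z) \<longlongrightarrow> toeplitz_conj B f z - toeplitz_conj B g z) (at_left 1)"
    by (intro tendsto_diff toeplitz_tendsto[OF B f p z] toeplitz_tendsto[OF B g p z])
  moreover have "\<forall>\<^sub>F s in at_left 1. toeplitz_mean B f s z - toeplitz_mean B g s z = toeplitz_mean B (\<lambda>z. f z - g z) s z"
    using eventually_at_left_unit
    by eventually_elim (simp add: toeplitz_mean_diff B h z)
  ultimately have "((\<lambda>s. toeplitz_mean B (\<lambda>z. f z - g z) s z) \<longlongrightarrow> toeplitz_conj B f z - toeplitz_conj B g z) (at_left 1)"
    by (rule Lim_transform_eventually)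
  then show ?thesis unfolding toeplitz_conj_eq[of B "\<lambda>z. f z - g z"] by (intro tendsto_Lim) auto
qed

lemma norm_toeplitz_le:
  assumes B: "in_Hinf_ball B" and f: "hp_le p f M" and p: "1 < p" and z: "norm z < 1"
  shows "norm (toeplitz_conj B f z) \<le> M powr (1 / p) / (1 - norm z)"
proof (rule tendsto_upperbound)
  show "((\<lambda>s. norm (toeplitz_mean B f s z)) \<longlongrightarrow> norm (toeplitz_conj B f z)) (at_left 1)"
    using f by (intro tendsto_norm toeplitz_tendsto[OF B _ p z]) (auto simp: in_Hp_iff_hp_le)
  show "\<forall>\<^sub>F s in at_left 1. norm (toeplitz_mean B f s z) \<le> M powr (1 / p) / (1 - norm z)"
    using eventually_at_left_unit by eventually_elim (simp add: norm_toeplitz_mean_le[OF B f p _ _ z])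
qed simp

lemma toeplitz_kernel_sum:
  assumes B: "in_Hinf_ball B" and w: "\<And>j. norm (w j) < 1" and z: "norm z < 1"
  shows "toeplitz_conj B (kernel_sum m c w) z = kernel_sum m (\<lambda>j. c j * cnj (B (w j))) w z"
  unfolding toeplitz_conj_eq
  using tendsto_uniform_limitI[OF toeplitz_mean_kernel_sum_limit[OF B w z, of m c], of z]
  by (intro tendsto_Lim) auto

text \<open>By Cauchy's formula the integral at radius s is the dilate f (s z), which tends to
  \<open>f z\<close> by continuity. This identifies the first term of the telescoping.\<close>

lemma toeplitz_one:
  assumes f: "f holomorphic_on ball 0 1" and z: "norm z < 1"
  shows "toeplitz_conj (\<lambda>_. 1) f z = f z"
proof -
  have "toeplitz_mean (\<lambda>_. 1) f s z = f (of_real s * z)" if s: "0 \<le> s" "s < 1" for s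
  proof -
    define G where "G = (\<lambda>u. f (of_real s * u))"
    have G: "G holomorphic_on cball 0 1" unfolding G_def by (intro dilate_holomorphic f s)
    have "G (cis t) / (1 - z * cnj (cis t)) = G (cis t) * cis t / (cis t - z)" for t
    proof -
      have "1 - z * cnj (cis t) = (cis t - z) / cis t" by (simp add: cnj_cis_eq diff_divide_distrib)
      then show ?thesis by simp
    qed
    then have "toeplitz_mean (\<lambda>_. 1) f s z = cmean (\<lambda>t. G (cis t) * cis t / (cis t - z))"
      by (simp add: toeplitz_mean_def szego_def G_def)
    also have "\<dots> = G z"
      using G holomorphic_on_subset[OF G ball_subset_cball] z
      by (intro Cauchy_circle_mean holomorphic_on_imp_continuous_on)
    finally show ?thesis by (simp add: G_def)
  qed
  then have ev: "\<forall>\<^sub>F s in at_left 1. f (of_real s * z) = toeplitz_mean (\<lambda>_. 1) f s z"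
    by (intro eventually_mono[OF eventually_at_left_unit]) auto
  have "isCont f z" using f z by (intro continuous_on_interior[OF holomorphic_on_imp_continuous_on]) auto
  moreover have "((\<lambda>s. complex_of_real s * z) \<longlongrightarrow> z) (at_left 1)"
    by (auto intro!: tendsto_eq_intros)
  ultimately have "((\<lambda>s. f (of_real s * z)) \<longlongrightarrow> f z) (at_left 1)"
    by (rule isCont_tendsto_compose)
  from Lim_transform_eventually[OF this ev]
  have "((\<lambda>s. toeplitz_mean (\<lambda>_. 1) f s z) \<longlongrightarrow> f z) (at_left 1)" .
  then show ?thesis unfolding toeplitz_conj_eq by (intro tendsto_Lim) auto
qed

text \<open>Riesz's inequality for the continuous data on radius s bounds every interior mean by a
  constant that depends on neither s nor B; the passage to s = 1 is made on a fixed inner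
  circle.\<close>

theorem toeplitz_bounded:
  assumes p: "1 < p"
  obtains C where "0 \<le> C"
    "\<And>B f M. \<lbrakk>in_Hinf_ball B; hp_le p f M\<rbrakk> \<Longrightarrow> hp_le p (toeplitz_conj B f) (C * M)"
proof -
  have p0: "0 < p" using p by simp
  obtain C where C: "0 \<le> C" and Ri: "\<And>h r. \<lbrakk>continuous_on UNIV h; 0 \<le> r; r < 1\<rbrakk> \<Longrightarrow>
       cmean (\<lambda>x. norm (szego h (of_real r * cis x)) powr p) \<le> C * cmean (\<lambda>t. norm (h t) powr p)"
    using riesz[OF p] by blast
  have "hp_le p (toeplitz_conj B f) (C * M)" if B: "in_Hinf_ball B" and f: "hp_le p f M" for B f M
  proof -
    have hf: "f holomorphic_on ball 0 1" using f by (simp add: hp_le_def)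
    have fH: "in_Hp p f" using f by (auto simp: in_Hp_iff_hp_le)
    have le: "circle_mean p (toeplitz_mean B f s) r \<le> C * M" if s: "0 \<le> s" "s < 1" and r: "0 \<le> r" "r < 1" for s r
    proof -
      have "circle_mean p (toeplitz_mean B f s) r
          \<le> C * cmean (\<lambda>t. norm (cnj (B (of_real s * cis t)) * f (of_real s * cis t)) powr p)"
        unfolding circle_mean_eq_cmean toeplitz_mean_def
        by (intro Ri continuous_on_toeplitz_integrand B hf s r)
      also have "\<dots> = C * circle_mean p (\<lambda>z. B z * f z) s"
        by (simp add: circle_mean_eq_cmean norm_mult)
      also have "\<dots> \<le> C * M"
        using hp_le_mult[OF B f p0] s C by (intro mult_left_mono) (auto simp: hp_le_def)
      finally show ?thesis .
    qed
    \<comment> \<open>Dominated convergence is a statement about sequences, so the limit is taken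
      along one that tends to 1 from the left.\<close>
    define \<sigma> where "\<sigma> = (\<lambda>n. 1 - 1 / real (n + 2))"
    have \<sigma>: "0 \<le> \<sigma> n" "\<sigma> n < 1" for n by (auto simp: \<sigma>_def)
    have "\<sigma> \<longlonglongrightarrow> 1 - 0"
      unfolding \<sigma>_def
      by (intro tendsto_diff tendsto_const LIMSEQ_ignore_initial_segment[OF lim_1_over_n])
    then have sig: "filterlim \<sigma> (at_left 1) sequentially"
      using \<sigma> by (simp add: filterlim_at less_imp_neq)
    have "circle_mean p (toeplitz_conj B f) r \<le> C * M" if r: "0 \<le> r" "r < 1" for r
    proof -
      let ?z = "\<lambda>t. complex_of_real r * cis t"
      have z: "norm (?z t) < 1" for t using r by (simp add: norm_mult)
      have "(\<lambda>n. integral {0..2*pi} (\<lambda>t. norm (toeplitz_mean B f (\<sigma> n) (?z t)) powr p))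
          \<longlonglongrightarrow> integral {0..2*pi} (\<lambda>t. norm (toeplitz_conj B f (?z t)) powr p)"
      proof (rule dominated_convergence(2))
        show "(\<lambda>t. norm (toeplitz_mean B f (\<sigma> n) (?z t)) powr p) integrable_on {0..2*pi}" for n
          using \<sigma> p0 r by (intro cont_integrable continuous_on_circle_powr toeplitz_mean_holomorphic B hf) auto
        \<comment> \<open>On a fixed circle the pointwise bound is a constant, hence an integrable
          majorant.\<close>
        show "(\<lambda>_. (M powr (1 / p) / (1 - r)) powr p) integrable_on {0..2*pi}"
          by (intro cont_integrable continuous_intros)
        show "norm (norm (toeplitz_mean B f (\<sigma> n) (?z t)) powr p) \<le> (M powr (1 / p) / (1 - r)) powr p" for n t
          using norm_toeplitz_mean_le[OF B f p \<sigma> z, of n t] p0 r by (auto simp: norm_mult intro!: powr_mono2)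
        show "(\<lambda>n. norm (toeplitz_mean B f (\<sigma> n) (?z t)) powr p) \<longlonglongrightarrow> norm (toeplitz_conj B f (?z t)) powr p" for t
          using filterlim_compose[OF toeplitz_tendsto[OF B fH p z] sig] p0
          by (intro tendsto_powr' tendsto_intros) auto
      qed
      then have "(\<lambda>n. circle_mean p (toeplitz_mean B f (\<sigma> n)) r) \<longlonglongrightarrow> circle_mean p (toeplitz_conj B f) r"
        unfolding circle_mean_def by (intro tendsto_mult_left)
      then show ?thesis
        by (rule LIMSEQ_le_const2) (use le \<sigma> r in auto)
    qed
    then show ?thesis
      using toeplitz_holomorphic[OF B fH p] by (simp add: hp_le_def)
  qed
  with C that show thesis by blast
qed

lemma in_Hinf_ball_mult:
  assumes "in_Hinf_ball B" "in_Hinf_ball b"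
  shows "in_Hinf_ball (\<lambda>z. B z * b z)"
  using assms unfolding in_Hinf_ball_def
  by (auto intro!: holomorphic_intros mult_le_one simp: norm_mult)

lemma in_Hp_toeplitz:
  assumes "in_Hinf_ball B" "in_Hp p f" "1 < p"
  shows "in_Hp p (toeplitz_conj B f)"
  using assms toeplitz_bounded[OF assms(3)] unfolding in_Hp_iff_hp_le by metis

text \<open>On kernel sums both sides multiply coefficients by the same conjugate values at the
  nodes. For general f the difference is estimated at the single point z: the pointwise bound
  handles the outer operators, norm boundedness the inner one.\<close>

lemma toeplitz_compose:
  assumes B: "in_Hinf_ball B" and b: "in_Hinf_ball b" and f: "in_Hp p f" and p: "1 < p" and z: "norm z < 1"
  shows "toeplitz_conj b (toeplitz_conj B f) z = toeplitz_conj (\<lambda>z. B z * b z) f z"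
proof -
  have p0: "0 < p" using p by simp
  note Bb = in_Hinf_ball_mult[OF B b]
  obtain C where C: "0 \<le> C" and bd: "\<And>B f M. \<lbrakk>in_Hinf_ball B; hp_le p f M\<rbrakk> \<Longrightarrow> hp_le p (toeplitz_conj B f) (C * M)"
    using toeplitz_bounded[OF p] by blast
  have le: "norm (toeplitz_conj b (toeplitz_conj B f) z - toeplitz_conj (\<lambda>z. B z * b z) f z)
      \<le> ((C * d) powr (1 / p) + d powr (1 / p)) / (1 - norm z)" if d: "0 < d" for d
  proof -
    obtain m c w where w: "\<And>j. norm (w j) < 1" and k: "hp_le p (\<lambda>z. f z - kernel_sum m c w z) d"
      by (rule kernel_sum_dense[OF p f d]) (rule that)
    let ?k = "kernel_sum m c w" and ?k' = "kernel_sum m (\<lambda>j. c j * cnj (B (w j))) w"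
    have kH: "in_Hp p ?k" "in_Hp p ?k'"
      unfolding in_Hp_iff_hp_le using hp_le_kernel_sum[of w p, OF w p0] by blast+
    have TH: "in_Hp p (toeplitz_conj B f)" by (rule in_Hp_toeplitz[OF B f p])
    have "hp_le p (\<lambda>z. toeplitz_conj B f z - ?k' z) (C * d)"
    proof (rule hp_le_cong[OF bd[OF B k]])
      fix z :: complex assume "norm z < 1"
      then show "toeplitz_conj B (\<lambda>z. f z - ?k z) z = toeplitz_conj B f z - ?k' z"
        using toeplitz_diff[OF B f kH(1) p] toeplitz_kernel_sum[OF B w] by simp
    qed
    from norm_toeplitz_le[OF b this p z]
    have 1: "norm (toeplitz_conj b (toeplitz_conj B f) z - toeplitz_conj b ?k' z) \<le> (C * d) powr (1 / p) / (1 - norm z)"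
      unfolding toeplitz_diff[OF b TH kH(2) p z] .
    from norm_toeplitz_le[OF Bb k p z]
    have 2: "norm (toeplitz_conj (\<lambda>z. B z * b z) f z - toeplitz_conj (\<lambda>z. B z * b z) ?k z) \<le> d powr (1 / p) / (1 - norm z)"
      unfolding toeplitz_diff[OF Bb f kH(1) p z] .
    have "toeplitz_conj b ?k' z = toeplitz_conj (\<lambda>z. B z * b z) ?k z"
      using toeplitz_kernel_sum[OF b w z] toeplitz_kernel_sum[OF Bb w z] by (simp add: mult.assoc)
    then have "norm (toeplitz_conj b (toeplitz_conj B f) z - toeplitz_conj (\<lambda>z. B z * b z) f z)
       = norm ((toeplitz_conj b (toeplitz_conj B f) z - toeplitz_conj b ?k' z)
           - (toeplitz_conj (\<lambda>z. B z * b z) f z - toeplitz_conj (\<lambda>z. B z * b z) ?k z))"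
      by simp
    also have "\<dots> \<le> (C * d) powr (1 / p) / (1 - norm z) + d powr (1 / p) / (1 - norm z)"
      by (rule order_trans[OF norm_triangle_ineq4 add_mono[OF 1 2]])
    finally show ?thesis by (simp add: add_divide_distrib)
  qed
  \<comment> \<open>The left side of \<open>le\<close> is free of d, so letting d tend to 0 makes it
    vanish.\<close>
  have "((\<lambda>d. ((C * d) powr (1 / p) + d powr (1 / p)) / (1 - norm z)) \<longlongrightarrow>
      ((C * 0) powr (1 / p) + 0 powr (1 / p)) / (1 - norm z)) (at_right 0)"
    using p0 z C by (intro tendsto_intros tendsto_powr') (auto simp: eventually_at_right_less intro!: eventually_at_rightI[of 0 1])
  then have "norm (toeplitz_conj b (toeplitz_conj B f) z - toeplitz_conj (\<lambda>z. B z * b z) f z) \<le> 0"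
    using p0 by (intro tendsto_lowerbound[where F = "at_right (0::real)"])
      (auto intro!: eventually_at_rightI[of 0 1] le)
  then show ?thesis by simp
qed

text \<open>Pointwise convergence of the symbols is enough because a kernel sum has finitely many
  nodes; the remainder is controlled by a constant common to all n.\<close>

lemma toeplitz_norm_tendsto_0:
  assumes p: "1 < p" and f: "in_Hp p f"
    and B: "\<And>n. in_Hinf_ball (B n)" and lim: "\<And>z. norm z < 1 \<Longrightarrow> (\<lambda>n. B n z) \<longlonglongrightarrow> 0"
    and e: "0 < e"
  shows "\<forall>\<^sub>F n in sequentially. hp_le p (toeplitz_conj (B n) f) e"
proof -
  have p0: "0 < p" using p by simp
  obtain C where C: "0 \<le> C" and bd: "\<And>B f M. \<lbrakk>in_Hinf_ball B; hp_le p f M\<rbrakk> \<Longrightarrow> hp_le p (toeplitz_conj B f) (C * M)"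
    using toeplitz_bounded[OF p] by blast
  define a where "a = e / (2 * 2 powr p)"
  have a: "0 < a" "2 powr p * (a + a) = e" using e by (auto simp: a_def)
  define d where "d = a / (C + 1)"
  have d: "0 < d" "C * d \<le> a" using a C by (auto simp: d_def field_simps)
  obtain m c w where w: "\<And>j. norm (w j) < 1" and k: "hp_le p (\<lambda>z. f z - kernel_sum m c w z) d"
    by (rule kernel_sum_dense[OF p f d(1)]) (rule that)
  have kH: "in_Hp p (kernel_sum m c w)"
    unfolding in_Hp_iff_hp_le using hp_le_kernel_sum[of w p, OF w p0] by blast
  \<comment> \<open>Bounds the supremum on the disc of the n-th operator applied to the kernel
    sum.\<close>
  define S where "S = (\<lambda>n. \<Sum>j<m. norm (c j * cnj (B n (w j))) / (1 - norm (w j)))"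
  have "S \<longlonglongrightarrow> (\<Sum>j<m. norm (c j * cnj 0) / (1 - norm (w j)))"
    unfolding S_def using w
    by (intro tendsto_intros lim) (auto simp: less_imp_neq)
  then have "S \<longlonglongrightarrow> 0" by simp
  moreover have "0 < a powr (1 / p)" using a by simp
  ultimately have "\<forall>\<^sub>F n in sequentially. S n < a powr (1 / p)"
    by (rule order_tendstoD(2))
  then show ?thesis
  proof eventually_elim
    case (elim n)
    have S0: "0 \<le> S n" unfolding S_def using w by (intro sum_nonneg divide_nonneg_nonneg) (auto intro: less_imp_le)
    have "S n powr p \<le> (a powr (1 / p)) powr p" using elim S0 p0 by (intro powr_mono2) auto
    also have "\<dots> = a" using a p0 by (simp add: powr_powr)
    finally have Sa: "S n powr p \<le> a" .
    have 1: "hp_le p (toeplitz_conj (B n) (\<lambda>z. f z - kernel_sum m c w z)) a"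
      using hp_le_mono[OF bd[OF B k] d(2)] .
    have 2: "hp_le p (kernel_sum m (\<lambda>j. c j * cnj (B n (w j))) w) a"
      using hp_le_mono[OF hp_le_kernel_sum[of w p, OF w p0] Sa[unfolded S_def]] .
    from hp_le_add[OF 1 2 p0]
    have "hp_le p (\<lambda>z. toeplitz_conj (B n) (\<lambda>z. f z - kernel_sum m c w z) z
        + kernel_sum m (\<lambda>j. c j * cnj (B n (w j))) w z) e"
      unfolding a(2) .
    then show ?case
    proof (rule hp_le_cong)
      fix z :: complex assume z: "norm z < 1"
      show "toeplitz_conj (B n) (\<lambda>z. f z - kernel_sum m c w z) z
        + kernel_sum m (\<lambda>j. c j * cnj (B n (w j))) w z = toeplitz_conj (B n) f z"
        using toeplitz_diff[OF B f kH p z] toeplitz_kernel_sum[OF B w z] by simp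
    qed
  qed
qed

section \<open>The telescoping series\<close>

lemma Bprod_0: "Bprod b 0 = (\<lambda>_. 1)"
  by (simp add: Bprod_def)

lemma Bprod_Suc: "Bprod b (Suc n) = (\<lambda>z. Bprod b n z * b (Suc n) z)"
  by (simp add: Bprod_def fun_eq_iff)

lemma in_Hinf_ball_Bprod:
  assumes "\<forall>n\<ge>1. in_Hinf_ball (b n)"
  shows "in_Hinf_ball (Bprod b n)"
proof (induction n)
  case 0
  show ?case by (simp add: Bprod_0 in_Hinf_ball_def)
next
  case (Suc n)
  then show ?case unfolding Bprod_Suc using assms by (intro in_Hinf_ball_mult) auto
qed

theorem theorem3p1:
  fixes p :: real and b :: "nat \<Rightarrow> complex \<Rightarrow> complex" and f :: "complex \<Rightarrow> complex"
  assumes "1 < p"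
    and "\<forall>n\<ge>1. in_Hinf_ball (b n)"
    and "\<forall>z\<in>ball 0 1. (\<lambda>n. Bprod b n z) \<longlonglongrightarrow> 0"
    and "in_Hp p f"
  shows "(\<forall>n\<ge>1. in_Hp p (\<lambda>z. Bprod b (n-1) z * Qop (b n) (toeplitz_conj (Bprod b (n-1)) f) z))
     \<and> (\<lambda>N. Hp_norm p (\<lambda>z. f z - (\<Sum>n\<in>{1..N}.
            Bprod b (n-1) z * Qop (b n) (toeplitz_conj (Bprod b (n-1)) f) z))) \<longlonglongrightarrow> 0"
proof -
  note p = \<open>1 < p\<close> and b = assms(2) and f = assms(4)
  have p0: "0 < p" using p by simp
  note B = in_Hinf_ball_Bprod[OF b]
  \<comment> \<open>On the disc \<open>u 0 = f\<close> and the N-th partial sum is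
    \<open>u 0 - u N\<close>, so the remainder of the series is exactly \<open>u N\<close>.\<close>
  define u where "u = (\<lambda>n z. Bprod b n z * toeplitz_conj (Bprod b n) f z)"
  have term_eq: "Bprod b n z * Qop (b (Suc n)) (toeplitz_conj (Bprod b n) f) z = u n z - u (Suc n) z"
    if z: "norm z < 1" for n z
  proof -
    have "in_Hinf_ball (b (Suc n))" using b by simp
    from toeplitz_compose[OF B this f p z] show ?thesis
      unfolding Qop_def u_def Bprod_Suc by (simp add: algebra_simps)
  qed
  have uH: "in_Hp p (u n)" for n
    unfolding u_def using in_Hp_toeplitz[OF B f p] hp_le_mult[OF B _ p0] unfolding in_Hp_iff_hp_le by blast
  have "in_Hp p (\<lambda>z. Bprod b (n-1) z * Qop (b n) (toeplitz_conj (Bprod b (n-1)) f) z)" if n: "n \<ge> 1" for n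
  proof -
    obtain k where k: "n = Suc k" using n by (cases n) auto
    obtain M where "hp_le p (\<lambda>z. u k z - u (Suc k) z) M"
      using in_Hp_diff[OF uH uH p0] unfolding in_Hp_iff_hp_le by blast
    then have "hp_le p (\<lambda>z. Bprod b k z * Qop (b (Suc k)) (toeplitz_conj (Bprod b k) f) z) M"
      by (rule hp_le_cong) (simp add: term_eq)
    then show ?thesis by (auto simp: k in_Hp_iff_hp_le)
  qed
  moreover have "(\<lambda>N. Hp_norm p (\<lambda>z. f z - (\<Sum>n\<in>{1..N}.
            Bprod b (n-1) z * Qop (b n) (toeplitz_conj (Bprod b (n-1)) f) z))) \<longlonglongrightarrow> 0"
    (is "(\<lambda>N. Hp_norm p (?R N)) \<longlonglongrightarrow> 0")
  proof (rule tendstoI)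
    fix e :: real assume e: "0 < e"
    have R: "u N z = ?R N z" if z: "norm z < 1" for N z
    proof (induction N)
      case 0
      show ?case
        using toeplitz_one[of f z] f z by (simp add: u_def Bprod_0 in_Hp_def)
    next
      case (Suc N)
      have "?R (Suc N) z = ?R N z - Bprod b N z * Qop (b (Suc N)) (toeplitz_conj (Bprod b N) f) z"
        by simp
      also have "\<dots> = u (Suc N) z"
        unfolding Suc.IH[symmetric] term_eq[OF z] by simp
      finally show ?case by (rule sym)
    qed
    \<comment> \<open>A p-th power because \<open>hp_le\<close> bounds p-th powers; e / 2 leaves
      room for the strict inequality.\<close>
    have "\<forall>\<^sub>F N in sequentially. hp_le p (toeplitz_conj (Bprod b N) f) ((e / 2) powr p)"
      using assms(3) e by (intro toeplitz_norm_tendsto_0 p f B) auto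
    then show "\<forall>\<^sub>F N in sequentially. dist (Hp_norm p (?R N)) 0 < e"
    proof eventually_elim
      case (elim N)
      \<comment> \<open>Multiplication by \<open>Bprod b N\<close> does not increase circle means,
        so smallness of the Toeplitz part suffices.\<close>
      have "hp_le p (u N) ((e / 2) powr p)"
        unfolding u_def by (rule hp_le_mult[OF B elim p0])
      then have "hp_le p (?R N) ((e / 2) powr p)"
        by (rule hp_le_cong) (rule R)
      then have "Hp_norm p (?R N) \<le> ((e / 2) powr p) powr (1 / p)"
        using p0 by (rule Hp_norm_le)
      also have "\<dots> = e / 2" using e p0 by (simp add: powr_powr)
      finally have "Hp_norm p (?R N) < e" using e by simp
      moreover have "0 \<le> Hp_norm p (?R N)" by (simp add: Hp_norm_def)
      ultimately show ?case by (simp add: dist_real_def)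
    qed
  qed
  ultimately show ?thesis by blast
qed

end
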